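(* Let $(X,T)$ and $(Y,R)$ be two minimal Cantor systems. Then there exists a Poincaré section $C\subset Y$ of $(Y,R)$ such that $(C,R_C)$ is topologically conjugate to $(X,T)$.
   Context: A minimal Cantor system is a pair $(X,T)$, $X$ a Cantor set, $T$ a homeomorphism with all orbits dense. For a minimal Cantor system $(Y,R)$, a Poincaré section is a nonempty closed set $C\subset Y$ such that the first return map $R_C:C\to C$, $R_C(x)=R^{r_C(x)}(x)$ with $r_C(x)=\inf\{n>0:R^nx\in C\}$, is a well-defined homeomorphism of $C$. *)

theory Defs
  imports "HOL-Analysis.Analysis"
begin

text \<open>A Cantor set: nonempty, compact, perfect, totally disconnected subset of a metric space
  (metrizability is built in by working inside a metric-space type).\<close>
definition cantor_set :: "'a::metric_space set \<Rightarrow> bool" where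
  "cantor_set X \<longleftrightarrow> X \<noteq> {} \<and> compact X \<and> (\<forall>x\<in>X. x islimpt X)
     \<and> (\<forall>x\<in>X. connected_component_set X x = {x})"

definition full_orbit :: "'a set \<Rightarrow> ('a \<Rightarrow> 'a) \<Rightarrow> 'a \<Rightarrow> 'a set" where
  "full_orbit X T x = {(T ^^ n) x | n. True} \<union> {(inv_into X T ^^ n) x | n. True}"

definition minimal_cantor_system :: "'a::metric_space set \<Rightarrow> ('a \<Rightarrow> 'a) \<Rightarrow> bool" where
  "minimal_cantor_system X T \<longleftrightarrow> cantor_set X \<and> (\<exists>g. homeomorphism X X T g)
     \<and> (\<forall>x\<in>X. X \<subseteq> closure (full_orbit X T x))"

definition return_time :: "('a \<Rightarrow> 'a) \<Rightarrow> 'a set \<Rightarrow> 'a \<Rightarrow> nat" where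
  "return_time R C x = (LEAST n. 0 < n \<and> (R ^^ n) x \<in> C)"

definition first_return_map :: "('a \<Rightarrow> 'a) \<Rightarrow> 'a set \<Rightarrow> 'a \<Rightarrow> 'a" where
  "first_return_map R C x = (R ^^ return_time R C x) x"

definition poincare_section :: "'a::metric_space set \<Rightarrow> ('a \<Rightarrow> 'a) \<Rightarrow> 'a set \<Rightarrow> bool" where
  "poincare_section Y R C \<longleftrightarrow> C \<noteq> {} \<and> C \<subseteq> Y \<and> closed C
     \<and> (\<forall>x\<in>C. \<exists>n>0. (R ^^ n) x \<in> C)
     \<and> (\<exists>g. homeomorphism C C (first_return_map R C) g)"

definition top_conjugate :: "'a::topological_space set \<Rightarrow> ('a \<Rightarrow> 'a) \<Rightarrow> 'b::topological_space set \<Rightarrow> ('b \<Rightarrow> 'b) \<Rightarrow> bool" where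
  "top_conjugate X T Y S \<longleftrightarrow> (\<exists>h g. homeomorphism X Y h g \<and> (\<forall>x\<in>X. h (T x) = S (h x)))"

end

theory Submission
  imports Defs
begin

text \<open>
  Fix \<open>w \<in> X\<close> and \<open>u \<in> Y\<close>. The embedding \<open>H : X \<rightarrow> Y\<close> is a uniform limit of locally constant maps \<open>h\<close>,
  each coming with a locally constant partial return time \<open>n\<close> such that \<open>h (T x) = R\<^bsup>n x\<^esup> (h x)\<close>
  wherever \<open>n\<close> is decided; the undecided set is a clopen neighbourhood of \<open>w\<close> shrinking to \<open>{w}\<close>.
  In the limit, \<open>H (T w) = R (H w)\<close> is enforced by keeping \<open>h w = u\<close> and \<open>h (T w) = R u\<close> throughout.

  To refine \<open>h\<close>, cut \<open>X\<close> into finitely many Rokhlin towers over the \<open>T\<close>-image of a smaller clopen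
  neighbourhood of \<open>w\<close>, and let each tower follow a single \<open>R\<close>-orbit segment that is close to the old
  values of \<open>h\<close>: decided steps are followed by continuity, undecided ones are filled by waiting until
  the orbit enters a small ball, which happens by minimality. The towers use distinct \<open>R\<close>-orbits,
  except that the tower starting at \<open>T w\<close> must start at \<open>R u\<close> and the one ending at \<open>w\<close> must end at
  \<open>u\<close>; their segments are still disjoint since \<open>R\<close> has no periodic points. Hence \<open>h\<close> separates levels
  and the orbit does not meet the image of \<open>h\<close> strictly between consecutive steps; both properties
  are open, so they survive in the limit when the refinements are small enough. The return time of
  \<open>H ` X\<close> is in general unbounded near \<open>H w\<close>, yet the first return map is \<open>H \<circ> T \<circ> H\<^sup>-\<^sup>1\<close>.
\<close>

subsection \<open>Locally constant functions\<close>

text \<open>Clopen subsets \<open>U\<close> of \<open>X\<close> are encoded throughout by local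
  constancy of the predicate \<open>\<lambda>z. z \<in> U\<close>; behaviour off \<open>X\<close> is
  ignored.\<close>

definition loc_const :: "'a::metric_space set \<Rightarrow> ('a \<Rightarrow> 'c) \<Rightarrow> bool" where
  "loc_const X f \<longleftrightarrow> (\<forall>x\<in>X. \<exists>e>0. \<forall>x'\<in>X. dist x' x < e \<longrightarrow> f x' = f x)"

lemma loc_constI:
  assumes "\<And>x. x \<in> X \<Longrightarrow> \<exists>e>0. \<forall>x'\<in>X. dist x' x < e \<longrightarrow> f x' = f x"
  shows "loc_const X f"
  using assms by (auto simp: loc_const_def)

lemma loc_const_const: "loc_const X (\<lambda>x. c)"
  by (auto simp: loc_const_def intro: zero_less_one)

lemma loc_const_apply: "loc_const X f \<Longrightarrow> loc_const X (\<lambda>x. F (f x))"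
  unfolding loc_const_def by metis

lemma loc_const_apply2:
  assumes "loc_const X f" "loc_const X g"
  shows "loc_const X (\<lambda>x. F (f x) (g x))"
proof (rule loc_constI)
  fix x assume "x \<in> X"
  then obtain d e where "d > 0" "\<forall>x'\<in>X. dist x' x < d \<longrightarrow> f x' = f x"
    "e > 0" "\<forall>x'\<in>X. dist x' x < e \<longrightarrow> g x' = g x"
    using assms unfolding loc_const_def by metis
  then show "\<exists>e>0. \<forall>x'\<in>X. dist x' x < e \<longrightarrow> F (f x') (g x') = F (f x) (g x)"
    by (intro exI[of _ "min d e"]) auto
qed

lemma loc_const_compose:
  assumes f: "loc_const X f" and g: "continuous_on X g" "g \<in> X \<rightarrow> X"
  shows "loc_const X (\<lambda>x. f (g x))"
proof (rule loc_constI)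
  fix x assume x: "x \<in> X"
  then obtain d where d: "d > 0" "\<forall>x'\<in>X. dist x' (g x) < d \<longrightarrow> f x' = f (g x)"
    using f g unfolding loc_const_def by blast
  obtain e where "e > 0" "\<forall>x'\<in>X. dist x' x < e \<longrightarrow> dist (g x') (g x) < d"
    using g(1) x d(1) unfolding continuous_on_iff by blast
  with d show "\<exists>e>0. \<forall>x'\<in>X. dist x' x < e \<longrightarrow> f (g x') = f (g x)"
    using g(2) by blast
qed

text \<open>Near \<open>x\<close> the index is frozen, so only the one function
  \<open>f (j x)\<close> matters there. This handles iterates whose exponent depends on the
  point.\<close>

lemma loc_const_select:
  assumes j: "loc_const X j" and f: "\<And>i. loc_const X (f i)"
  shows "loc_const X (\<lambda>x. f (j x) x)"
proof (rule loc_constI)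
  fix x assume "x \<in> X"
  then obtain d e where "d > 0" "\<forall>x'\<in>X. dist x' x < d \<longrightarrow> j x' = j x"
    "e > 0" "\<forall>x'\<in>X. dist x' x < e \<longrightarrow> f (j x) x' = f (j x) x"
    using assms unfolding loc_const_def by metis
  then show "\<exists>e>0. \<forall>x'\<in>X. dist x' x < e \<longrightarrow> f (j x') x' = f (j x) x"
    by (intro exI[of _ "min d e"]) auto
qed

lemma loc_const_map_upt:
  fixes f :: "nat \<Rightarrow> 'a::metric_space \<Rightarrow> 'c"
  assumes "\<And>i. loc_const X (f i)"
  shows "loc_const X (\<lambda>x. map (\<lambda>i. f i x) [0..<n])"
proof (induction n)
  case (Suc n)
  have "loc_const X (\<lambda>x. map (\<lambda>i. f i x) [0..<n] @ [f n x])"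
    by (rule loc_const_apply2[OF Suc assms])
  then show ?case by simp
qed (simp add: loc_const_const)

text \<open>Being the minimum depends only on the truth values of the \<open>P i\<close> up to that
  index, and these finitely many are frozen on a common neighbourhood.\<close>

lemma loc_const_Least:
  fixes P :: "nat \<Rightarrow> 'a::metric_space \<Rightarrow> bool"
  assumes P: "\<And>i. loc_const X (P i)" and ex: "\<And>x. x \<in> X \<Longrightarrow> \<exists>i. P i x"
  shows "loc_const X (\<lambda>x. LEAST i. P i x)"
proof (rule loc_constI)
  fix x assume x: "x \<in> X"
  let ?n = "LEAST i. P i x"
  obtain e where e: "e > 0"
    "\<forall>x'\<in>X. dist x' x < e \<longrightarrow> map (\<lambda>i. P i x') [0..<Suc ?n] = map (\<lambda>i. P i x) [0..<Suc ?n]"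
    using loc_const_map_upt[of X P "Suc ?n", OF P] x unfolding loc_const_def by blast
  have "(LEAST i. P i x') = ?n" if x': "x' \<in> X" "dist x' x < e" for x'
  proof -
    have same: "P i x' = P i x" if "i \<le> ?n" for i
    proof -
      have "\<forall>i\<in>set [0..<Suc ?n]. P i x' = P i x"
        using e(2) x' by (metis map_eq_conv)
      then show ?thesis using that by force
    qed
    show ?thesis
    proof (rule Least_equality)
      show "P ?n x'" using same[of ?n] LeastI_ex[OF ex[OF x]] by simp
      show "?n \<le> i" if "P i x'" for i
        using that same[of i] not_less_Least[of i "\<lambda>i. P i x"] by force
    qed
  qed
  with e(1) show "\<exists>e>0. \<forall>x'\<in>X. dist x' x < e \<longrightarrow> (LEAST i. P i x') = ?n" by blast
qed

lemma loc_const_finite_image: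
  assumes "compact X" "loc_const X f"
  shows "finite (f ` X)"
proof -
  obtain e where e: "\<And>x. x \<in> X \<Longrightarrow> e x > 0"
    "\<And>x x'. x \<in> X \<Longrightarrow> x' \<in> X \<Longrightarrow> dist x' x < e x \<Longrightarrow> f x' = f x"
    using assms(2) unfolding loc_const_def by metis
  have "X \<subseteq> (\<Union>x\<in>X. ball x (e x))" using e(1) by force
  then obtain D where D: "D \<subseteq> X" "finite D" "X \<subseteq> (\<Union>x\<in>D. ball x (e x))"
    using compactE_image[OF assms(1), of X "\<lambda>x. ball x (e x)"] by auto
  have "f ` X \<subseteq> f ` D"
  proof
    fix v assume "v \<in> f ` X"
    then obtain x where x: "x \<in> X" "v = f x" by blast
    then obtain z where "z \<in> D" "dist z x < e z" using D(3) by auto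
    then show "v \<in> f ` D" using e(2)[of z x] x D(1) by (auto simp: dist_commute)
  qed
  then show ?thesis using D(2) finite_surj by blast
qed

section \<open>Clopen neighbourhoods and fine clopen partitions of a Cantor set\<close>

lemma cantor_set_clopen_nbhd:
  assumes X: "cantor_set X" and x: "x \<in> X" and e: "e > 0"
  obtains U where "x \<in> U" "U \<subseteq> X" "U \<subseteq> ball x e" "loc_const X (\<lambda>z. z \<in> U)"
proof -
  let ?T = "top_of_set X"
  have cpt: "compact X" using X by (simp add: cantor_set_def)
  have comp: "{x} \<in> connected_components_of ?T"
  proof -
    have "connected_component_of_set ?T x = connected_component_set X x"
      by (auto simp: connected_component_of_def connected_component_def connectedin_subtopology)
    also have "\<dots> = {x}" using X x by (simp add: cantor_set_def)
    finally show ?thesis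
      using connected_component_in_connected_components_of[of ?T x] x by simp
  qed
  have "openin ?T (X \<inter> ball x e)" by (simp add: openin_open_Int)
  moreover have "locally_compact_space ?T"
    using cpt by (simp add: compact_imp_locally_compact_space compact_space_subtopology)
  moreover have "Hausdorff_space ?T"
    by (simp add: Hausdorff_space_subtopology)
  moreover have "compactin ?T {x}" using x by simp
  moreover have "{x} \<subseteq> X \<inter> ball x e" using x e by simp
  \<comment> \<open>Total disconnectedness makes \<open>{x}\<close> a component, and a compact
    component of a locally compact Hausdorff space has arbitrarily small clopen
    neighbourhoods.\<close>
  ultimately obtain U V where UV: "openin ?T U" "openin ?T V" "disjnt U V" "U \<union> V = topspace ?T"
     "{x} \<subseteq> U" "U \<subseteq> X \<inter> ball x e"
    using wilder_locally_compact_component_thm comp by metis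
  have "loc_const X (\<lambda>z. z \<in> U)"
  proof (rule loc_constI)
    fix z assume "z \<in> X"
    then consider "z \<in> U" | "z \<in> V" using UV by auto
    then show "\<exists>e>0. \<forall>z'\<in>X. dist z' z < e \<longrightarrow> (z' \<in> U) = (z \<in> U)"
    proof cases
      case 1
      with UV(1) show ?thesis unfolding openin_euclidean_subtopology_iff by (meson)
    next
      case 2
      with UV(2) obtain e where "e > 0" "\<forall>z'\<in>X. dist z' z < e \<longrightarrow> z' \<in> V"
        unfolding openin_euclidean_subtopology_iff by meson
      with 2 UV(3) show ?thesis by (metis disjnt_iff)
    qed
  qed
  with UV that show thesis by blast
qed

text \<open>Finitely many clopen sets, each inside a ball of radius \<open>e/2\<close>, cover
  \<open>X\<close>. The label \<open>q z\<close> is the set of those containing \<open>z\<close>, so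
  points with equal labels lie in a common one.\<close>

lemma cantor_set_fine_loc_const:
  fixes X :: "'a::metric_space set"
  assumes X: "cantor_set X" and e: "e > 0"
  obtains q :: "'a \<Rightarrow> 'a set set" where "loc_const X q"
    "\<And>x x'. x \<in> X \<Longrightarrow> x' \<in> X \<Longrightarrow> q x = q x' \<Longrightarrow> dist x x' < e"
proof -
  have "\<forall>x\<in>X. \<exists>U. x \<in> U \<and> U \<subseteq> ball x (e/2) \<and> loc_const X (\<lambda>z. z \<in> U)"
  proof
    fix x assume "x \<in> X"
    have "e / 2 > 0" using e by simp
    then obtain U where "x \<in> U" "U \<subseteq> ball x (e/2)" "loc_const X (\<lambda>z. z \<in> U)"
      by (rule cantor_set_clopen_nbhd[OF X \<open>x \<in> X\<close>])
    then show "\<exists>U. x \<in> U \<and> U \<subseteq> ball x (e/2) \<and> loc_const X (\<lambda>z. z \<in> U)"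
      by (intro exI[of _ U] conjI)
  qed
  from bchoice[OF this] obtain U where
    "\<forall>x\<in>X. x \<in> U x \<and> U x \<subseteq> ball x (e/2) \<and> loc_const X (\<lambda>z. z \<in> U x)" ..
  then have U: "\<And>x. x \<in> X \<Longrightarrow> x \<in> U x" "\<And>x. x \<in> X \<Longrightarrow> U x \<subseteq> ball x (e/2)"
    "\<And>x. x \<in> X \<Longrightarrow> loc_const X (\<lambda>z. z \<in> U x)" by auto
  have "\<exists>d>0. \<forall>z\<in>X. dist z x < d \<longrightarrow> z \<in> U x" if x: "x \<in> X" for x
  proof -
    obtain d where "d > 0" "\<forall>z\<in>X. dist z x < d \<longrightarrow> (z \<in> U x) = (x \<in> U x)"
      using bspec[OF U(3)[OF x, unfolded loc_const_def] x] by (elim exE conjE)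
    with U(1)[OF x] show ?thesis by (intro exI[of _ d]) simp
  qed
  then obtain d where d: "\<And>x. x \<in> X \<Longrightarrow> d x > 0"
    "\<And>x z. x \<in> X \<Longrightarrow> z \<in> X \<Longrightarrow> dist z x < d x \<Longrightarrow> z \<in> U x" by metis
  have cpt: "compact X" using X by (simp add: cantor_set_def)
  have "X \<subseteq> (\<Union>x\<in>X. ball x (d x))" using d(1) by force
  then obtain D where D: "D \<subseteq> X" "finite D" "X \<subseteq> (\<Union>x\<in>D. ball x (d x))"
    using compactE_image[OF cpt, of X "\<lambda>x. ball x (d x)"] by auto
  define q where "q z = {U x |x. x \<in> D \<and> z \<in> U x}" for z
  have "loc_const X (\<lambda>z. {U x |x. x \<in> E \<and> z \<in> U x})" if "finite E" "E \<subseteq> X" for E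
    using that
  proof (induction E rule: finite_induct)
    case (insert a E)
    have "loc_const X (\<lambda>z. (if z \<in> U a then {U a} else {}) \<union> {U x |x. x \<in> E \<and> z \<in> U x})"
      using insert.prems by (intro loc_const_apply2[OF U(3) insert.IH]) auto
    moreover have "(\<lambda>z. (if z \<in> U a then {U a} else {}) \<union> {U x |x. x \<in> E \<and> z \<in> U x})
        = (\<lambda>z. {U x |x. x \<in> insert a E \<and> z \<in> U x})" by (auto simp: fun_eq_iff)
    ultimately show ?case by simp
  qed (simp add: loc_const_const)
  then have "loc_const X q" unfolding q_def using D by blast
  moreover have "dist x x' < e" if "x \<in> X" "x' \<in> X" "q x = q x'" for x x'
  proof -
    obtain a where a: "a \<in> D" "dist a x < d a" using D(3) \<open>x \<in> X\<close> by auto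
    then have "x \<in> U a" using d(2)[of a x] D(1) \<open>x \<in> X\<close> by (auto simp: dist_commute)
    then have "U a \<in> q x'" using a that(3) unfolding q_def by blast
    then have "x' \<in> U a" unfolding q_def by auto
    with \<open>x \<in> U a\<close> have "dist a x < e/2" "dist a x' < e/2" using U(2)[of a] a D(1)
      by (meson mem_ball subsetD)+
    then show ?thesis by (metis dist_commute dist_triangle_half_l)
  qed
  ultimately show thesis by (rule that)
qed

subsection \<open>Minimal homeomorphisms\<close>

text \<open>The inverse \<open>S\<close> is a parameter, so the assumptions are symmetric in
  \<open>R\<close> and \<open>S\<close> and every result also serves backward iterates.\<close>

locale minimal_system =
  fixes Y :: "'b::metric_space set" and R S :: "'b \<Rightarrow> 'b"
  assumes compact: "compact Y"
    and perfect: "y \<in> Y \<Longrightarrow> y islimpt Y"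
    and cont: "continuous_on Y R" and cont_inv: "continuous_on Y S"
    and into: "y \<in> Y \<Longrightarrow> R y \<in> Y" and into_inv: "y \<in> Y \<Longrightarrow> S y \<in> Y"
    and inv_left: "y \<in> Y \<Longrightarrow> S (R y) = y" and inv_right: "y \<in> Y \<Longrightarrow> R (S y) = y"
    and dense: "y \<in> Y \<Longrightarrow> open V \<Longrightarrow> V \<inter> Y \<noteq> {} \<Longrightarrow> \<exists>n. (R ^^ n) y \<in> V \<or> (S ^^ n) y \<in> V"
begin

lemma inverse_system: "minimal_system Y S R"
proof
  show "\<exists>n. (S ^^ n) y \<in> V \<or> (R ^^ n) y \<in> V" if "y \<in> Y" "open V" "V \<inter> Y \<noteq> {}" for y V
    using dense[OF that] by auto
qed (simp_all add: compact perfect cont cont_inv into into_inv inv_left inv_right)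

lemma iter_into: "y \<in> Y \<Longrightarrow> (R ^^ n) y \<in> Y"
  by (induction n) (auto simp: into)

lemma cont_iter: "continuous_on Y (R ^^ n)"
proof (induction n)
  case (Suc n)
  have "continuous_on Y (R \<circ> (R ^^ n))"
    by (rule continuous_on_compose[OF Suc continuous_on_subset[OF cont]]) (auto simp: iter_into)
  then show ?case by simp
qed simp

lemma iter_inv_left: "y \<in> Y \<Longrightarrow> (S ^^ n) ((R ^^ n) y) = y"
proof (induction n)
  case (Suc n)
  then have "(S ^^ Suc n) ((R ^^ Suc n) y) = (S ^^ n) (S (R ((R ^^ n) y)))"
    by (simp add: funpow_swap1)
  then show ?case using Suc by (simp add: inv_left iter_into)
qed simp

lemma iter_inv_diff:
  assumes "y \<in> Y" "m \<le> n"
  shows "(S ^^ m) ((R ^^ n) y) = (R ^^ (n - m)) y"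
proof -
  have "(R ^^ n) y = (R ^^ m) ((R ^^ (n - m)) y)"
    using assms(2) by (metis add_diff_inverse_nat comp_apply funpow_add not_le)
  then show ?thesis using assms by (simp add: iter_inv_left iter_into)
qed

text \<open>Compactness reduces the two-sided hits of \<open>dense\<close> to finitely many times,
  bounded by \<open>M\<close>. Starting from \<open>(R ^^ (M+1)) y\<close> turns even a backward hit
  into one at positive time.\<close>

lemma hits:
  assumes "open V" "V \<inter> Y \<noteq> {}"
  obtains N where "\<And>y. y \<in> Y \<Longrightarrow> \<exists>n\<le>N. 0 < n \<and> (R ^^ n) y \<in> V"
proof -
  interpret inv: minimal_system Y S R by (rule inverse_system)
  define H where "H m = {y \<in> Y. (R ^^ m) y \<in> V} \<union> {y \<in> Y. (S ^^ m) y \<in> V}" for m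
  have op: "openin (top_of_set Y) (H m)" for m
  proof -
    have "H m = Y \<inter> (R ^^ m) -` V \<union> Y \<inter> (S ^^ m) -` V" by (auto simp: H_def)
    then show ?thesis
      by (simp add: openin_Un continuous_openin_preimage_gen cont_iter inv.cont_iter assms(1))
  qed
  have "Y \<subseteq> \<Union>(range H)" unfolding H_def using dense[OF _ assms] by auto
  then obtain D where D: "D \<subseteq> range H" "finite D" "Y \<subseteq> \<Union>D"
    using compact op unfolding compact_eq_openin_cover by (metis (no_types, lifting) imageE)
  then obtain I where I: "finite I" "D = H ` I" by (meson finite_subset_image)
  obtain M where M: "\<forall>i\<in>I. i \<le> M" using I(1) by (meson finite_nat_set_iff_bounded_le)
  have "\<exists>n\<le>2*M+1. 0 < n \<and> (R ^^ n) y \<in> V" if y: "y \<in> Y" for y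
  proof -
    let ?y = "(R ^^ (M+1)) y"
    have "?y \<in> Y" using y iter_into by blast
    then obtain m where m: "m \<in> I" "?y \<in> H m" using D I by auto
    then have "m \<le> M" using M by blast
    from m(2) consider "(R ^^ m) ?y \<in> V" | "(S ^^ m) ?y \<in> V" by (auto simp: H_def)
    then show ?thesis
    proof cases
      case 1
      then have "(R ^^ (m + (M+1))) y \<in> V" by (metis comp_apply funpow_add)
      then show ?thesis using \<open>m \<le> M\<close> by (intro exI[of _ "m + (M+1)"]) auto
    next
      case 2
      then have "(R ^^ (M+1-m)) y \<in> V" using iter_inv_diff[OF y, of m "M+1"] \<open>m \<le> M\<close> by simp
      then show ?thesis using \<open>m \<le> M\<close> by (intro exI[of _ "M+1-m"]) auto
    qed
  qed
  then show thesis by (rule that)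
qed

text \<open>Baire category: without isolated points, singletons are nowhere dense, so countably many
  of them cannot fill a ball. This is what allows orbits to be avoided later.\<close>

lemma ball_uncountable:
  assumes p: "p \<in> Y" and "d > 0" and D: "countable D"
  obtains y where "y \<in> Y" "dist y p < d" "y \<notin> D"
proof -
  let ?T = "top_of_set Y" and ?G = "(\<lambda>y. {y}) ` (D \<inter> Y)"
  have "?T interior_of \<Union>?G = {}"
  proof (rule Baire_category_alt)
    show "completely_metrizable_space ?T \<or> locally_compact_space ?T \<and> regular_space ?T"
      using compact
      by (simp add: compact_imp_locally_compact_space compact_space_subtopology
          compact_Hausdorff_imp_regular_space Hausdorff_space_subtopology)
    show "countable ?G" using D by blast
    fix A assume "A \<in> ?G"
    then obtain a where a: "A = {a}" "a \<in> Y" by blast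
    have "\<not> openin ?T {a}"
    proof
      assume "openin ?T {a}"
      then obtain e where "e > 0" "\<forall>x\<in>Y. dist x a < e \<longrightarrow> x = a"
        unfolding openin_euclidean_subtopology_iff by auto
      then show False using perfect[OF a(2)] unfolding islimpt_approachable by metis
    qed
    then have "?T interior_of {a} = {}"
      by (metis interior_of_subset openin_interior_of subset_singletonD)
    then show "closedin ?T A \<and> ?T interior_of A = {}" using a by (simp add: closed_subset)
  qed
  moreover have "openin ?T (Y \<inter> ball p d)" by (simp add: openin_open_Int)
  ultimately have "\<not> Y \<inter> ball p d \<subseteq> D"
    using interior_of_maximal[of "Y \<inter> ball p d" "\<Union>?G" ?T] p \<open>d > 0\<close> by fastforce
  then obtain y where "y \<in> Y \<inter> ball p d" "y \<notin> D" by blast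
  then show thesis using that[of y] by (simp add: dist_commute)
qed

text \<open>A periodic orbit would be finite, hence closed, while \<open>dense\<close> forces it to
  meet every nonempty open set, and \<open>Y\<close> has points outside any finite set.\<close>

lemma aperiodic:
  assumes y: "y \<in> Y" and eq: "(R ^^ a) y = (R ^^ b) y"
  shows "a = b"
proof -
  have *: False if "(R ^^ n) y = y" "n > 0" for n
  proof -
    have Rm: "(R ^^ m) y = (R ^^ (m mod n)) y" for m
      using that(1) by (metis funpow_mod_eq)
    have Sm: "(S ^^ m) y \<in> (\<lambda>i. (R ^^ i) y) ` {..<n}" for m
    proof -
      \<comment> \<open>The exponent \<open>m * n\<close> is a multiple of the period and at least
        \<open>m\<close>, so the backward iterate can be rewritten as a forward one.\<close>
      have "(R ^^ (m * n)) y = y" using Rm[of "m * n"] by simp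
      then have "(S ^^ m) y = (S ^^ m) ((R ^^ (m * n)) y)" by simp
      also have "\<dots> = (R ^^ (m * n - m)) y" using iter_inv_diff[OF y] that(2) by simp
      finally show ?thesis using Rm[of "m * n - m"] that(2) by auto
    qed
    let ?O = "(\<lambda>i. (R ^^ i) y) ` {..<n}"
    obtain z where z: "z \<in> Y" "z \<notin> ?O"
      using ball_uncountable[OF y zero_less_one, of ?O] by auto
    have "open (- ?O)" by (simp add: finite_imp_closed open_Compl)
    then obtain m where "(R ^^ m) y \<in> - ?O \<or> (S ^^ m) y \<in> - ?O"
      using dense[OF y, of "- ?O"] z by blast
    then show False using Rm[of m] Sm[of m] that(2) by auto
  qed
  have **: "i = j" if "i \<le> j" "(R ^^ i) y = (R ^^ j) y" for i j
  proof -
    have "(R ^^ (j - i)) y = y" using iter_inv_diff[OF y that(1)] that(2) iter_inv_left[OF y] by metis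
    then have "\<not> 0 < j - i" using * by blast
    then show ?thesis using that(1) by simp
  qed
  show ?thesis using **[of a b] **[of b a] eq by (metis nat_le_linear)
qed

end

subsection \<open>Orbit segments following prescribed points\<close>

text \<open>The point \<open>y\<close> visits the \<open>e\<close>-balls around \<open>p 0, \<dots>, p t\<close> at the cumulative times \<open>s 0 < \<dots> < s t\<close>.
  A value \<open>n i > 0\<close> prescribes the \<open>i\<close>-th waiting time, while \<open>n i = 0\<close> leaves it free.\<close>
definition tracks ::
  "('b::metric_space \<Rightarrow> 'b) \<Rightarrow> nat \<Rightarrow> (nat \<Rightarrow> 'b) \<Rightarrow> (nat \<Rightarrow> nat) \<Rightarrow> real \<Rightarrow> 'b \<Rightarrow> (nat \<Rightarrow> nat) \<Rightarrow> bool" where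
  "tracks R t p n e y s \<longleftrightarrow> s 0 = 0
     \<and> (\<forall>i<t. s i < s (Suc i) \<and> (0 < n i \<longrightarrow> s (Suc i) = s i + n i))
     \<and> (\<forall>i\<le>t. dist ((R ^^ s i) y) (p i) < e)"

lemma tracks_strict_mono:
  assumes "tracks R t p n e y s" "i < j" "j \<le> t"
  shows "s i < s j"
  using assms(2,3)
proof (induction j)
  case (Suc j)
  have "s j < s (Suc j)" using assms(1) Suc.prems unfolding tracks_def by simp
  then show ?case using Suc by (cases "i = j") auto
qed simp

lemma tracks_mono:
  assumes "tracks R t p n e y s" "i \<le> j" "j \<le> t"
  shows "s i \<le> s j"
  using tracks_strict_mono[OF assms(1), of i j] assms by (cases "i = j") auto

context minimal_system
begin

text \<open>Induction peels off the first target: it suffices to reach the ball around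
  \<open>p 1\<close> from which the rest can be followed. A prescribed wait does this by continuity,
  a free one by minimality.\<close>

lemma track_exists:
  assumes "\<And>i. i \<le> t \<Longrightarrow> p i \<in> Y"
    and "\<And>i. i < t \<Longrightarrow> 0 < n i \<Longrightarrow> p (Suc i) = (R ^^ n i) (p i)" and e: "e > 0"
  shows "\<exists>d>0. \<forall>y\<in>Y. dist y (p 0) < d \<longrightarrow> (\<exists>s. tracks R t p n e y s)"
  using assms(1,2)
proof (induction t arbitrary: p n)
  case 0
  have "tracks R 0 p n e y (\<lambda>_. 0)" if "dist y (p 0) < e" for y
    using that by (simp add: tracks_def)
  then show ?case using e by blast
next
  case (Suc t)
  obtain d where d: "d > 0"
    "\<And>y. y \<in> Y \<Longrightarrow> dist y (p (Suc 0)) < d \<Longrightarrow> \<exists>s. tracks R t (\<lambda>i. p (Suc i)) (\<lambda>i. n (Suc i)) e y s"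
    using Suc.IH[of "\<lambda>i. p (Suc i)" "\<lambda>i. n (Suc i)"] Suc.prems by auto
  have "\<exists>d'>0. \<forall>y\<in>Y. dist y (p 0) < d' \<longrightarrow>
      (\<exists>m>0. (0 < n 0 \<longrightarrow> m = n 0) \<and> dist ((R ^^ m) y) (p (Suc 0)) < d)"
  proof (cases "n 0 > 0")
    case True
    have p1: "p (Suc 0) = (R ^^ n 0) (p 0)" using Suc.prems(2)[of 0] True by simp
    obtain d' where "d' > 0" "\<forall>y\<in>Y. dist y (p 0) < d' \<longrightarrow> dist ((R ^^ n 0) y) (p (Suc 0)) < d"
      using cont_iter[of "n 0"] Suc.prems(1)[of 0] d(1) unfolding continuous_on_iff p1 by blast
    then show ?thesis using True by blast
  next
    case False
    obtain N where N: "\<And>y. y \<in> Y \<Longrightarrow> \<exists>m\<le>N. 0 < m \<and> (R ^^ m) y \<in> ball (p (Suc 0)) d"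
      using hits[of "ball (p (Suc 0)) d"] Suc.prems(1)[of "Suc 0"] d(1)
      by (metis IntI Suc_le_mono centre_in_ball empty_iff le0 open_ball)
    have "\<forall>y\<in>Y. \<exists>m>0. dist ((R ^^ m) y) (p (Suc 0)) < d"
      using N by (metis dist_commute mem_ball)
    \<comment> \<open>A free wait reaches the ball from every point of \<open>Y\<close>, so any
      radius will do.\<close>
    then show ?thesis using False by (intro exI[of _ 1]) auto
  qed
  then obtain d' where d': "d' > 0" "\<And>y. y \<in> Y \<Longrightarrow> dist y (p 0) < d' \<Longrightarrow>
      \<exists>m>0. (0 < n 0 \<longrightarrow> m = n 0) \<and> dist ((R ^^ m) y) (p (Suc 0)) < d" by blast
  have "\<exists>s. tracks R (Suc t) p n e y s" if y: "y \<in> Y" "dist y (p 0) < min e d'" for y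
  proof -
    obtain m where m: "m > 0" "0 < n 0 \<longrightarrow> m = n 0" "dist ((R ^^ m) y) (p (Suc 0)) < d"
      using d'(2)[OF y(1)] y(2) by (metis min_less_iff_conj)
    obtain s where s: "tracks R t (\<lambda>i. p (Suc i)) (\<lambda>i. n (Suc i)) e ((R ^^ m) y) s"
      using d(2)[OF iter_into[OF y(1)] m(3)] by blast
    have add: "(R ^^ (m + k)) y = (R ^^ k) ((R ^^ m) y)" for k
      by (metis add.commute comp_apply funpow_add)
    have "tracks R (Suc t) p n e y (\<lambda>i. case i of 0 \<Rightarrow> 0 | Suc i \<Rightarrow> m + s i)"
      using s m(1,2) y(2) unfolding tracks_def
      by (auto simp: add less_Suc_eq_0_disj le_Suc_eq split: nat.split)
    then show ?thesis by blast
  qed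
  then show ?case using e d'(1) by (intro exI[of _ "min e d'"]) auto
qed

text \<open>The reversed targets are tracked by the inverse system from exactly \<open>p t\<close>;
  reading that track backwards fixes its end point instead of its start.\<close>

lemma track_exists_to_end:
  assumes pY: "\<And>i. i \<le> t \<Longrightarrow> p i \<in> Y"
    and step: "\<And>i. i < t \<Longrightarrow> 0 < n i \<Longrightarrow> p (Suc i) = (R ^^ n i) (p i)" and e: "e > 0"
  obtains y s where "y \<in> Y" "tracks R t p n e y s" "(R ^^ s t) y = p t"
proof -
  interpret inv: minimal_system Y S R by (rule inverse_system)
  let ?p = "\<lambda>i. p (t - i)" and ?n = "\<lambda>i. n (t - Suc i)"
  have "\<exists>d>0. \<forall>y\<in>Y. dist y (?p 0) < d \<longrightarrow> (\<exists>s. tracks S t ?p ?n e y s)"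
  proof (rule inv.track_exists)
    show "?p i \<in> Y" for i using pY by simp
    show "?p (Suc i) = (S ^^ ?n i) (?p i)" if i: "i < t" "0 < ?n i" for i
    proof -
      have "Suc (t - Suc i) = t - i" using i(1) by simp
      then have "p (t - i) = (R ^^ ?n i) (p (t - Suc i))" using step[of "t - Suc i"] i by simp
      then show ?thesis using iter_inv_left pY by simp
    qed
  qed (rule e)
  then obtain s where s: "tracks S t ?p ?n e (p t) s" using pY[of t] by auto
  define y where "y = (S ^^ s t) (p t)"
  define s' where "s' i = s t - s (t - i)" for i
  have s0: "s 0 = 0" using s by (simp add: tracks_def)
  have le: "s (t - i) \<le> s t" for i using tracks_mono[OF s, of "t - i" t] by simp
  have R: "(R ^^ s' i) y = (S ^^ s (t - i)) (p t)" for i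
    using inv.iter_inv_diff[of "p t" "s' i" "s t"] pY[of t] le[of i] by (simp add: y_def s'_def)
  have "tracks R t p n e y s'"
    unfolding tracks_def
  proof (intro conjI allI impI)
    show "s' 0 = 0" by (simp add: s'_def)
    fix i assume i: "i < t"
    then have *: "t - i = Suc (t - Suc i)" by simp
    have **: "s (t - Suc i) < s (t - i)" "0 < n i \<longrightarrow> s (t - i) = s (t - Suc i) + n i"
      using s i unfolding tracks_def * by (auto dest!: spec[of _ "t - Suc i"] simp: Suc_diff_Suc)
    show "s' i < s' (Suc i)" using ** le[of i] by (simp add: s'_def)
    show "s' (Suc i) = s' i + n i" if "0 < n i" using ** le[of i] that by (simp add: s'_def)
  next
    fix i assume i: "i \<le> t"
    have "\<forall>i\<le>t. dist ((S ^^ s i) (p t)) (p (t - i)) < e" using s by (simp add: tracks_def)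
    from this[rule_format, of "t - i"] show "dist ((R ^^ s' i) y) (p i) < e"
      using i by (simp add: R)
  qed
  moreover have "(R ^^ s' t) y = p t" using R[of t] s0 by simp
  moreover have "y \<in> Y" using inv.iter_into pY[of t] by (simp add: y_def)
  ultimately show thesis using that by blast
qed

section \<open>Orbit segments on pairwise different orbits\<close>

definition orbit :: "'b \<Rightarrow> 'b set" where
  "orbit z = {v \<in> Y. \<exists>a b. (R ^^ a) v = (R ^^ b) z}"

lemma countable_orbit: "countable (orbit z)"
proof -
  have "orbit z \<subseteq> (\<lambda>(a, b). (S ^^ a) ((R ^^ b) z)) ` UNIV"
  proof
    fix v assume "v \<in> orbit z"
    then obtain a b where "v \<in> Y" "(R ^^ a) v = (R ^^ b) z" by (auto simp: orbit_def)
    then have "v = (S ^^ a) ((R ^^ b) z)" by (metis iter_inv_left)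
    then show "v \<in> (\<lambda>(a, b). (S ^^ a) ((R ^^ b) z)) ` UNIV" by auto
  qed
  then show ?thesis by (rule countable_subset) auto
qed

text \<open>The points are chosen one at a time: \<open>D\<close> and the orbits already used form a
  countable set, which \<open>ball_uncountable\<close> avoids.\<close>

lemma distinct_orbits:
  assumes "finite K" "countable D" "\<And>c. c \<in> K \<Longrightarrow> p c \<in> Y" "\<And>c. c \<in> K \<Longrightarrow> d c > 0"
  shows "\<exists>y. (\<forall>c\<in>K. y c \<in> Y \<and> dist (y c) (p c) < d c \<and> y c \<notin> D)
    \<and> (\<forall>c\<in>K. \<forall>c'\<in>K. c \<noteq> c' \<longrightarrow> y c \<notin> orbit (y c'))"
  using assms(1,3,4)
proof (induction K rule: finite_induct)
  case (insert c K)
  then obtain y where y: "\<forall>c\<in>K. y c \<in> Y \<and> dist (y c) (p c) < d c \<and> y c \<notin> D"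
    "\<forall>c\<in>K. \<forall>c'\<in>K. c \<noteq> c' \<longrightarrow> y c \<notin> orbit (y c')" by auto
  have "countable (D \<union> (\<Union>c'\<in>K. orbit (y c')))"
    using insert.hyps assms(2) countable_orbit by (simp add: countable_finite)
  moreover have "p c \<in> Y" "d c > 0" using insert.prems by auto
  ultimately obtain z where "z \<in> Y" "dist z (p c) < d c" "z \<notin> D \<union> (\<Union>c'\<in>K. orbit (y c'))"
    by (metis ball_uncountable)
  then have z: "z \<in> Y" "dist z (p c) < d c" "z \<notin> D" "\<And>c'. c' \<in> K \<Longrightarrow> z \<notin> orbit (y c')"
    by auto
  \<comment> \<open>Sharing an orbit means that some forward iterates agree, which is symmetric for
    points of \<open>Y\<close>.\<close>
  have sym: "y c' \<notin> orbit z" if "c' \<in> K" for c'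
    using z(1) z(4)[OF that] unfolding orbit_def by auto metis
  show ?case
    by (rule exI[of _ "y(c := z)"]) (use y z sym insert.hyps in auto)
qed simp

text \<open>The index \<open>c\<^sub>0\<close> stands for the tower starting at \<open>T w\<close>, and \<open>c\<^sub>1\<close> for the one ending at \<open>w\<close>.\<close>
lemma choose_tracks:
  fixes K :: "'c set"
  assumes K: "finite K" and c: "c\<^sub>0 \<in> K" "c\<^sub>1 \<in> K" "c\<^sub>0 \<noteq> c\<^sub>1"
    and pY: "\<And>c i. c \<in> K \<Longrightarrow> i \<le> t c \<Longrightarrow> p c i \<in> Y"
    and step: "\<And>c i. c \<in> K \<Longrightarrow> i < t c \<Longrightarrow> 0 < n c i \<Longrightarrow> p c (Suc i) = (R ^^ n c i) (p c i)"
    and e: "e > 0" and u: "u \<in> Y" "p c\<^sub>0 0 = R u" "p c\<^sub>1 (t c\<^sub>1) = u"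
  obtains y s where "\<And>c. c \<in> K \<Longrightarrow> y c \<in> Y"
    "\<And>c. c \<in> K \<Longrightarrow> tracks R (t c) (p c) (n c) e (y c) (s c)"
    "y c\<^sub>0 = R u" "(R ^^ s c\<^sub>1 (t c\<^sub>1)) (y c\<^sub>1) = u"
    "\<And>c c' a b. c \<in> K \<Longrightarrow> c' \<in> K \<Longrightarrow> c \<noteq> c' \<Longrightarrow> a \<le> s c (t c) \<Longrightarrow> b \<le> s c' (t c')
      \<Longrightarrow> (R ^^ a) (y c) \<noteq> (R ^^ b) (y c')"
proof -
  have "\<forall>c\<in>K. \<exists>d>0. \<forall>y\<in>Y. dist y (p c 0) < d \<longrightarrow> (\<exists>s. tracks R (t c) (p c) (n c) e y s)"
  proof
    fix c assume "c \<in> K"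
    then show "\<exists>d>0. \<forall>y\<in>Y. dist y (p c 0) < d \<longrightarrow> (\<exists>s. tracks R (t c) (p c) (n c) e y s)"
      using pY step e by (intro track_exists) auto
  qed
  then obtain d where d: "\<And>c. c \<in> K \<Longrightarrow> d c > 0"
    "\<And>c y. c \<in> K \<Longrightarrow> y \<in> Y \<Longrightarrow> dist y (p c 0) < d c \<Longrightarrow> \<exists>s. tracks R (t c) (p c) (n c) e y s"
    by metis
  \<comment> \<open>All towers except the two special ones get different orbits, none of them the
    orbit of \<open>u\<close>.\<close>
  have "\<exists>y. (\<forall>c\<in>K - {c\<^sub>0, c\<^sub>1}. y c \<in> Y \<and> dist (y c) (p c 0) < d c \<and> y c \<notin> orbit u)
    \<and> (\<forall>c\<in>K - {c\<^sub>0, c\<^sub>1}. \<forall>c'\<in>K - {c\<^sub>0, c\<^sub>1}. c \<noteq> c' \<longrightarrow> y c \<notin> orbit (y c'))"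
    using K d(1) pY countable_orbit by (intro distinct_orbits) auto
  then obtain y' where
    "\<forall>c\<in>K - {c\<^sub>0, c\<^sub>1}. y' c \<in> Y \<and> dist (y' c) (p c 0) < d c \<and> y' c \<notin> orbit u"
    "\<forall>c\<in>K - {c\<^sub>0, c\<^sub>1}. \<forall>c'\<in>K - {c\<^sub>0, c\<^sub>1}. c \<noteq> c' \<longrightarrow> y' c \<notin> orbit (y' c')"
    by (elim exE conjE)
  then have y': "\<And>c. c \<in> K - {c\<^sub>0, c\<^sub>1} \<Longrightarrow> y' c \<in> Y \<and> dist (y' c) (p c 0) < d c \<and> y' c \<notin> orbit u"
    "\<And>c c'. c \<in> K - {c\<^sub>0, c\<^sub>1} \<Longrightarrow> c' \<in> K - {c\<^sub>0, c\<^sub>1} \<Longrightarrow> c \<noteq> c' \<Longrightarrow> y' c \<notin> orbit (y' c')"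
    by blast+
  obtain y1 s1 where y1: "y1 \<in> Y" "tracks R (t c\<^sub>1) (p c\<^sub>1) (n c\<^sub>1) e y1 s1" "(R ^^ s1 (t c\<^sub>1)) y1 = u"
  proof (rule track_exists_to_end[of "t c\<^sub>1" "p c\<^sub>1" "n c\<^sub>1" e])
    show "p c\<^sub>1 i \<in> Y" if "i \<le> t c\<^sub>1" for i using pY c(2) that by blast
    show "p c\<^sub>1 (Suc i) = (R ^^ n c\<^sub>1 i) (p c\<^sub>1 i)" if "i < t c\<^sub>1" "0 < n c\<^sub>1 i" for i
      using step c(2) that by blast
  qed (use e u(3) in auto)
  define y where "y = y'(c\<^sub>0 := R u, c\<^sub>1 := y1)"
  have yY: "y c \<in> Y" if "c \<in> K" for c
    using that y'(1)[of c] y1(1) into[OF u(1)] by (auto simp: y_def)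
  have "\<exists>s. tracks R (t c) (p c) (n c) e (y c) s \<and> (c = c\<^sub>1 \<longrightarrow> s = s1)" if "c \<in> K" for c
  proof (cases "c = c\<^sub>1")
    case False
    \<comment> \<open>For \<open>c\<^sub>0\<close> the distance is zero, since the base value
      \<open>R u\<close> is exactly the first target.\<close>
    have "dist (y c) (p c 0) < d c"
      using that y'(1)[of c] u(2) d(1)[of c\<^sub>0] c False by (auto simp: y_def)
    then show ?thesis using d(2)[OF that yY[OF that]] False by blast
  qed (use y1(2) in \<open>simp add: y_def\<close>)
  then obtain s where s: "\<And>c. c \<in> K \<Longrightarrow> tracks R (t c) (p c) (n c) e (y c) (s c)" "s c\<^sub>1 = s1"
    using c(2) by metis
  have y01: "y c\<^sub>0 = R u" "y c\<^sub>1 = y1" using c(3) by (auto simp: y_def)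
  have in_orbit: "z \<in> orbit u" if "z \<in> Y" "(R ^^ a) z = (R ^^ b) (y c)" "c = c\<^sub>0 \<or> c = c\<^sub>1" for z a b c
    using that(3)
  proof
    assume "c = c\<^sub>0"
    then have "(R ^^ a) z = (R ^^ Suc b) u" using that(2) y01 by (simp add: funpow_swap1)
    then show ?thesis unfolding orbit_def using that(1) by blast
  next
    assume "c = c\<^sub>1"
    then have "(R ^^ (s1 (t c\<^sub>1) + a)) z = (R ^^ b) u"
      using that(2) y01 y1(3) by (metis add.commute comp_apply funpow_add)
    then show ?thesis unfolding orbit_def using that(1) by blast
  qed
  have one: "(R ^^ a) (y c) \<noteq> (R ^^ b) (y c')" if "c \<in> K - {c\<^sub>0, c\<^sub>1}" "c' \<in> K" "c \<noteq> c'" for c c' a b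
  proof
    assume eq: "(R ^^ a) (y c) = (R ^^ b) (y c')"
    have yc: "y c = y' c" using that by (auto simp: y_def)
    show False
    proof (cases "c' = c\<^sub>0 \<or> c' = c\<^sub>1")
      case True
      then show False using in_orbit[OF yY eq] that y'(1)[of c] yc by auto
    next
      case False
      then have "y c' = y' c'" by (simp add: y_def)
      then have "y' c \<in> orbit (y' c')" using eq yc yY[of c] that unfolding orbit_def by auto
      then show False using y'(2)[of c c'] that False by blast
    qed
  qed
  \<comment> \<open>Both special segments lie on the orbit of \<open>u\<close>, one ending at
    \<open>u\<close> and the other starting at \<open>R u\<close>. A common point would make
    \<open>u\<close> periodic.\<close>
  have two: "(R ^^ a) (y c\<^sub>0) \<noteq> (R ^^ b) (y c\<^sub>1)" if "b \<le> s c\<^sub>1 (t c\<^sub>1)" for a b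
  proof
    assume eq: "(R ^^ a) (y c\<^sub>0) = (R ^^ b) (y c\<^sub>1)"
    let ?k = "s1 (t c\<^sub>1) - b"
    have "(R ^^ (?k + Suc a)) u = (R ^^ ?k) ((R ^^ a) (y c\<^sub>0))"
      by (simp add: y01 funpow_add funpow_swap1)
    also have "\<dots> = (R ^^ (?k + b)) y1" unfolding eq by (simp add: y01 funpow_add)
    also have "\<dots> = (R ^^ 0) u" using that y1(3) s(2) by simp
    finally show False using aperiodic[OF u(1)] by blast
  qed
  have "(R ^^ a) (y c) \<noteq> (R ^^ b) (y c')"
    if cc: "c \<in> K" "c' \<in> K" "c \<noteq> c'" "a \<le> s c (t c)" "b \<le> s c' (t c')" for c c' a b
  proof -
    consider "c \<in> K - {c\<^sub>0, c\<^sub>1}" | "c' \<in> K - {c\<^sub>0, c\<^sub>1}" | "c = c\<^sub>0" "c' = c\<^sub>1" | "c = c\<^sub>1" "c' = c\<^sub>0"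
      using cc by blast
    then show ?thesis
    proof cases
      case 1 then show ?thesis using one cc by blast
    next
      case 2 then show ?thesis using one[of c' c b a] cc by metis
    next
      case 3 then show ?thesis using two cc by blast
    next
      case 4 then show ?thesis using two[of a b] cc by metis
    qed
  qed
  then show thesis using that[of y s] yY s y01 y1(3) by simp
qed

text \<open>Each inequality \<open>(R ^^ i) v \<noteq> v'\<close> is an open condition by
  continuity, and only finitely many triples occur, so a smallest radius works for all.\<close>

lemma separation_margin:
  assumes "finite V" "V \<subseteq> Y"
  obtains r where "r > 0" "\<And>v v' i u u'. v \<in> V \<Longrightarrow> v' \<in> V \<Longrightarrow> i \<le> N \<Longrightarrow> (R ^^ i) v \<noteq> v' \<Longrightarrow>
    u \<in> Y \<Longrightarrow> dist u v < r \<Longrightarrow> dist u' v' < r \<Longrightarrow> (R ^^ i) u \<noteq> u'"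
proof -
  define P where "P = (\<lambda>(v, v', i) r. \<forall>u\<in>Y. \<forall>u'. dist u v < r \<longrightarrow> dist u' v' < r \<longrightarrow> (R ^^ i) u \<noteq> u')"
  define F where "F = {(v, v', i). v \<in> V \<and> v' \<in> V \<and> i \<le> N \<and> (R ^^ i) v \<noteq> v'}"
  have fin: "finite F"
    by (rule finite_subset[of _ "V \<times> V \<times> {..N}"]) (use assms(1) in \<open>auto simp: F_def\<close>)
  have "\<exists>r>0. P x r" if xF: "x \<in> F" for x
  proof -
    obtain v v' i where x: "x = (v, v', i)" "v \<in> V" "(R ^^ i) v \<noteq> v'" using xF unfolding F_def by blast
    let ?d = "dist ((R ^^ i) v) v' / 2"
    have "?d > 0" using x by simp
    then obtain d where d: "d > 0" "\<forall>u\<in>Y. dist u v < d \<longrightarrow> dist ((R ^^ i) u) ((R ^^ i) v) < ?d"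
      using cont_iter[of i] x(2) assms(2) unfolding continuous_on_iff by blast
    have "P x (min d ?d)"
      unfolding P_def x prod.case
    proof (intro ballI allI impI notI)
      fix u u' assume u: "u \<in> Y" "dist u v < min d ?d" "dist u' v' < min d ?d" "(R ^^ i) u = u'"
      then have "dist u' ((R ^^ i) v) < ?d" "dist u' v' < ?d" using d(2) by auto
      then show False using dist_triangle3[of "(R ^^ i) v" v' u'] by linarith
    qed
    then show ?thesis using d(1) \<open>?d > 0\<close> by (intro exI[of _ "min d ?d"]) simp
  qed
  then obtain g where g: "\<And>x. x \<in> F \<Longrightarrow> g x > 0 \<and> P x (g x)" by metis
  \<comment> \<open>The extra \<open>1\<close> keeps the minimum defined when no triple
    qualifies.\<close>
  define r where "r = Min (insert 1 (g ` F))"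
  have "r > 0" unfolding r_def using fin g by (subst Min_gr_iff) auto
  moreover have "(R ^^ i) u \<noteq> u'" if "v \<in> V" "v' \<in> V" "i \<le> N" "(R ^^ i) v \<noteq> v'"
    "u \<in> Y" "dist u v < r" "dist u' v' < r" for v v' i u u'
  proof -
    have x: "(v, v', i) \<in> F" using that by (simp add: F_def)
    have "r \<le> g (v, v', i)" using x fin unfolding r_def by (intro Min_le) auto
    moreover have "P (v, v', i) (g (v, v', i))" using g[OF x] by blast
    ultimately show ?thesis using that(5-7) unfolding P_def by force
  qed
  ultimately show thesis by (rule that)
qed

end

subsection \<open>Refining an approximate embedding\<close>

locale minimal_pair = X: minimal_system X T T' + Y: minimal_system Y R S
  for X :: "'a::metric_space set" and T T' and Y :: "'b::metric_space set" and R S +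
  fixes w :: 'a and u :: 'b
  assumes cantor: "cantor_set X" and w: "w \<in> X" and u: "u \<in> Y"
begin

sublocale X_inv: minimal_system X T' T by (rule X.inverse_system)

text \<open>\<open>n x = 0\<close> means that the return time at \<open>x\<close> is still undecided.\<close>
definition approx :: "('a \<Rightarrow> 'b) \<Rightarrow> ('a \<Rightarrow> nat) \<Rightarrow> bool" where
  "approx h n \<longleftrightarrow> loc_const X h \<and> loc_const X n \<and> (\<forall>x\<in>X. h x \<in> Y)
     \<and> (\<forall>x\<in>X. 0 < n x \<longrightarrow> h (T x) = (R ^^ n x) (h x))
     \<and> h w = u \<and> h (T w) = R u \<and> n w = 0"

text \<open>As \<open>e\<close> tends to 0, the three clauses yield in turn: a decided return time
  at every point other than \<open>w\<close>, injectivity, and no earlier return to the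
  image.\<close>

definition separated :: "('a \<Rightarrow> 'b) \<Rightarrow> ('a \<Rightarrow> nat) \<Rightarrow> real \<Rightarrow> bool" where
  "separated h n e \<longleftrightarrow> (\<forall>x\<in>X. n x = 0 \<longrightarrow> dist x w < e)
     \<and> (\<forall>x\<in>X. \<forall>x'\<in>X. h x = h x' \<longrightarrow> dist x x' < e)
     \<and> (\<forall>x\<in>X. \<forall>x'\<in>X. \<forall>i. 0 < i \<and> i < n x \<longrightarrow> (R ^^ i) (h x) \<noteq> h x')"

lemma T_T'_iter: "x \<in> X \<Longrightarrow> (T ^^ n) ((T' ^^ n) x) = x"
  by (rule X_inv.iter_inv_left)

lemma approx_refine:
  assumes hn: "approx h n" and e: "e > 0" and d: "d > 0"
  shows "\<exists>h' n'. approx h' n' \<and> separated h' n' e \<and> (\<forall>x\<in>X. dist (h' x) (h x) < d \<and> (0 < n x \<longrightarrow> n' x = n x))"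
proof -
  have h_lc: "loc_const X h" and n_lc: "loc_const X n" and hY: "\<And>x. x \<in> X \<Longrightarrow> h x \<in> Y"
    and hT: "\<And>x. x \<in> X \<Longrightarrow> 0 < n x \<Longrightarrow> h (T x) = (R ^^ n x) (h x)"
    and hw: "h w = u" "h (T w) = R u" "n w = 0"
    using hn unfolding approx_def by auto
  obtain U where U: "w \<in> U" "U \<subseteq> X" "U \<subseteq> ball w e" "loc_const X (\<lambda>z. z \<in> U)"
    by (rule cantor_set_clopen_nbhd[OF cantor w e])
  \<comment> \<open>\<open>Z\<close> will be the new undecided set. Lying in \<open>U\<close> makes
    it small, and requiring \<open>n x = 0\<close> ensures that no decided time is lost.\<close>
  define Z where "Z = {x \<in> U. n x = 0}"
  have Z: "w \<in> Z" "Z \<subseteq> X" using U hw(3) by (auto simp: Z_def)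
  have Z_lc: "loc_const X (\<lambda>z. z \<in> Z)"
    unfolding Z_def using loc_const_apply2[OF U(4) n_lc, of "\<lambda>p k. p \<and> k = 0"] by simp
  \<comment> \<open>As a neighbourhood of \<open>w\<close>, \<open>Z\<close> is reached from every
    point both forward and backward; the forward bound \<open>N\<close> also bounds all tower
    heights.\<close>
  obtain r where r: "r > 0" "\<And>x. x \<in> X \<Longrightarrow> dist x w < r \<Longrightarrow> x \<in> Z"
    using bspec[OF Z_lc[unfolded loc_const_def] w] Z(1) by blast
  have ball_ne: "ball w r \<inter> X \<noteq> {}" using w r(1) by (metis IntI centre_in_ball empty_iff)
  obtain N where N: "\<And>x. x \<in> X \<Longrightarrow> \<exists>i\<le>N. 0 < i \<and> (T ^^ i) x \<in> ball w r"
    by (rule X.hits[OF open_ball ball_ne]) (rule that, blast)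
  obtain N' where N': "\<And>x. x \<in> X \<Longrightarrow> \<exists>i\<le>N'. 0 < i \<and> (T' ^^ i) x \<in> ball w r"
    by (rule X_inv.hits[OF open_ball ball_ne]) (rule that, blast)
  have fwd: "\<exists>i\<le>N. (T ^^ i) x \<in> Z" if "x \<in> X" for x
    using N[OF that] r(2) X.iter_into[OF that] by (metis dist_commute mem_ball)
  have bwd: "\<exists>i. (T' ^^ Suc i) x \<in> Z" if "x \<in> X" for x
    using N'[OF that] r(2) X_inv.iter_into[OF that] by (metis dist_commute mem_ball gr0_implies_Suc)

  \<comment> \<open>\<open>b x\<close> is the base point of the tower over \<open>T ` Z\<close> through \<open>x\<close>, \<open>j x\<close> the level of \<open>x\<close>, and \<open>t z\<close>
    the top level over the base point \<open>z\<close>.\<close>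
  define j where "j x = (LEAST i. (T' ^^ Suc i) x \<in> Z)" for x
  define b where "b x = (T' ^^ j x) x" for x
  define t where "t z = (LEAST i. (T ^^ i) z \<in> Z)" for z
  have j_Z: "(T' ^^ Suc (j x)) x \<in> Z" if "x \<in> X" for x
    unfolding j_def by (rule LeastI_ex[OF bwd[OF that]])
  have j_le: "j x \<le> i" if "(T' ^^ Suc i) x \<in> Z" for x i
    unfolding j_def using that by (rule Least_le)
  have t_Z: "(T ^^ t z) z \<in> Z" if "z \<in> X" for z
    unfolding t_def using fwd[OF that] by (metis LeastI)
  have t_le: "t z \<le> i" if "(T ^^ i) z \<in> Z" for z i
    unfolding t_def using that by (rule Least_le)
  have t_N: "t z \<le> N" if "z \<in> X" for z
    using fwd[OF that] t_le by (meson le_trans)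
  have bX: "b x \<in> X" if "x \<in> X" for x using X_inv.iter_into that by (simp add: b_def)
  have Tb: "(T ^^ j x) (b x) = x" if "x \<in> X" for x using T_T'_iter that by (simp add: b_def)
  \<comment> \<open>Meeting \<open>Z\<close> below level \<open>j x\<close> on the way up would mean
    meeting it sooner on the way down from \<open>x\<close>, against the minimality of
    \<open>j x\<close>.\<close>
  have j_t: "j x \<le> t (b x)" if x: "x \<in> X" for x
  proof (rule ccontr)
    assume "\<not> j x \<le> t (b x)"
    then have lt: "t (b x) < j x" by simp
    have "(T ^^ t (b x)) (b x) = (T' ^^ (j x - t (b x))) x"
      unfolding b_def by (rule X_inv.iter_inv_diff[OF x]) (use lt in \<open>simp add: b_def\<close>)
    also have "j x - t (b x) = Suc (j x - t (b x) - 1)" using lt by simp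
    finally have "(T' ^^ Suc (j x - t (b x) - 1)) x \<in> Z" using t_Z[OF bX[OF x]] by simp
    from j_le[OF this] show False using lt by simp
  qed
  have j_t_eq: "j x = t (b x)" if "x \<in> Z" for x
    using j_t[of x] t_le[of "j x" "b x"] Tb[of x] that Z(2) by force
  have j_t_less: "j x < t (b x)" if x: "x \<in> X" "x \<notin> Z" for x
    using j_t[OF x(1)] t_Z[OF bX[OF x(1)]] Tb[OF x(1)] x(2) by (metis le_neq_implies_less)
  have j_T: "j (T x) = Suc (j x)" if x: "x \<in> X" "x \<notin> Z" for x
  proof -
    have shift: "(T' ^^ Suc i) (T x) = (T' ^^ i) x" for i
      by (simp only: funpow_Suc_right comp_apply X.inv_left[OF x(1)])
    \<comment> \<open>Index 0 fails for \<open>T x\<close> because its preimage \<open>x\<close> is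
      outside \<open>Z\<close>, so the search is that for \<open>x\<close> shifted by one.\<close>
    have "(LEAST i. (T' ^^ Suc i) (T x) \<in> Z) = Suc (LEAST m. (T' ^^ Suc (Suc m)) (T x) \<in> Z)"
      using j_Z[OF X.into[OF x(1)]] by (rule Least_Suc) (use x shift[of 0] in simp)
    then show ?thesis unfolding j_def shift .
  qed
  have b_T: "b (T x) = b x" if x: "x \<in> X" "x \<notin> Z" for x
    unfolding b_def j_T[OF x] by (simp only: funpow_Suc_right comp_apply X.inv_left[OF x(1)])
  have jw: "j (T w) = 0" "b (T w) = T w"
    using j_le[of 0 "T w"] X.inv_left[OF w] Z(1) by (simp_all add: b_def)
  \<comment> \<open>If the tower ending at \<open>w\<close> also started at \<open>T w\<close>, then
    \<open>b w\<close> would be periodic.\<close>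
  have bw: "T w \<noteq> b w"
  proof
    assume "T w = b w"
    then have "(T ^^ Suc (j w)) (b w) = (T ^^ 0) (b w)" using Tb[OF w] by simp
    then show False using X.aperiodic[OF bX[OF w]] by blast
  qed

  \<comment> \<open>The resolution \<open>e'\<close> keeps the tower starting at \<open>T w\<close> apart from the one ending at \<open>w\<close>.\<close>
  define e' where "e' = min e (dist (T w) (b w))"
  have "e' > 0" using e bw by (simp add: e'_def)
  then obtain q :: "'a \<Rightarrow> 'a set set" where q: "loc_const X q"
    "\<And>x x'. x \<in> X \<Longrightarrow> x' \<in> X \<Longrightarrow> q x = q x' \<Longrightarrow> dist x x' < e'"
    using cantor_set_fine_loc_const[OF cantor] by metis
  define Q where "Q x = ((q x, h x), (n x, x \<in> Z))" for x
  have Q_lc: "loc_const X Q"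
    unfolding Q_def by (intro loc_const_apply2[where F = Pair] q(1) h_lc n_lc Z_lc)
  \<comment> \<open>The list has the fixed length \<open>N + 1\<close>, enough for any tower. Since
    \<open>Q\<close> records membership in \<open>Z\<close>, it also determines the height, see
    \<open>G_t\<close>.\<close>
  define G where "G z = map (\<lambda>i. Q ((T ^^ i) z)) [0..<Suc N]" for z
  have TiX: "T ^^ i \<in> X \<rightarrow> X" for i using X.iter_into by auto
  have T'iX: "T' ^^ i \<in> X \<rightarrow> X" for i using X_inv.iter_into by auto
  have G_lc: "loc_const X G"
    unfolding G_def by (intro loc_const_map_upt loc_const_compose[OF Q_lc X.cont_iter TiX])
  have G_eq: "Q ((T ^^ i) z) = Q ((T ^^ i) z')" if "G z = G z'" "i \<le> N" for z z' i
  proof -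
    have "\<forall>i\<in>set [0..<Suc N]. Q ((T ^^ i) z) = Q ((T ^^ i) z')"
      using that(1) unfolding G_def by (metis map_eq_conv)
    then show ?thesis using that(2) by force
  qed
  have G_t: "t z = t z'" if "G z = G z'" "z \<in> X" "z' \<in> X" for z z'
  proof -
    have "t z \<le> t z'" if "G z = G z'" "z \<in> X" "z' \<in> X" for z z'
      using G_eq[OF that(1) t_N[OF that(3)]] t_Z[OF that(3)] t_le[of "t z'" z] by (simp add: Q_def)
    from this[of z z'] this[of z' z] that show ?thesis by simp
  qed
  define code where "code x = G (b x)" for x
  have j_lc: "loc_const X j"
    unfolding j_def by (rule loc_const_Least[OF loc_const_compose[OF Z_lc X_inv.cont_iter T'iX] bwd])
  have code_lc: "loc_const X code"
    unfolding code_def b_def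
    by (rule loc_const_select[OF j_lc loc_const_compose[OF G_lc X_inv.cont_iter T'iX]])
  define K where "K = code ` X"
  have K_fin: "finite K" unfolding K_def by (rule loc_const_finite_image[OF X.compact code_lc])
  \<comment> \<open>The representative \<open>\<zeta> c\<close> may be any point with this code, not
    necessarily a base point: only the values of \<open>Q\<close> along its first
    \<open>N + 1\<close> iterates are used.\<close>
  have "\<forall>c\<in>K. \<exists>z. z \<in> X \<and> G z = c" unfolding K_def code_def using bX by auto
  from bchoice[OF this] obtain \<zeta> where \<zeta>: "\<And>c. c \<in> K \<Longrightarrow> \<zeta> c \<in> X" "\<And>c. c \<in> K \<Longrightarrow> G (\<zeta> c) = c"
    by auto
  have code_K: "code x \<in> K" if "x \<in> X" for x using that by (simp add: K_def)
  have G_code: "G (\<zeta> (code x)) = G (b x)" if "x \<in> X" for x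
    using \<zeta>(2)[OF code_K[OF that]] by (simp add: code_def)
  have t_code: "t (\<zeta> (code x)) = t (b x)" if "x \<in> X" for x
    using G_t[OF G_code] \<zeta>(1)[OF code_K] bX that by blast
  have Q_code: "Q ((T ^^ j x) (\<zeta> (code x))) = Q x" if "x \<in> X" for x
    using G_eq[OF G_code[OF that], of "j x"] j_t[OF that] t_N[OF bX[OF that]] Tb[OF that] by simp
  have wT: "T w \<in> X" using X.into w by blast
  have codes_ne: "code (T w) \<noteq> code w"
  proof
    assume "code (T w) = code w"
    then have "Q (T w) = Q (b w)" using G_eq[of "T w" "b w" 0] jw(2) by (simp add: code_def)
    then have "dist (T w) (b w) < e'" using q(2)[OF wT bX[OF w]] by (simp add: Q_def)
    then show False by (simp add: e'_def)
  qed

  \<comment> \<open>The old values and times along the representative become the targets and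
    prescribed waits; old undecided times become free waits.\<close>
  define p where "p c i = h ((T ^^ i) (\<zeta> c))" for c i
  define m where "m c i = n ((T ^^ i) (\<zeta> c))" for c i
  define \<tau> where "\<tau> c = t (\<zeta> c)" for c
  have pY: "p c i \<in> Y" if "c \<in> K" for c i
    unfolding p_def using hY X.iter_into \<zeta>(1)[OF that] by blast
  have pstep: "p c (Suc i) = (R ^^ m c i) (p c i)" if "c \<in> K" "0 < m c i" for c i
    using hT[OF X.iter_into[OF \<zeta>(1)[OF that(1)]]] that(2) by (simp add: p_def m_def)
  have p_code: "p (code x) (j x) = h x" and m_code: "m (code x) (j x) = n x" if "x \<in> X" for x
    using Q_code[OF that] by (simp_all add: p_def m_def Q_def)
  have \<tau>_code: "\<tau> (code x) = t (b x)" if "x \<in> X" for x using t_code[OF that] by (simp add: \<tau>_def)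
  have j_\<tau>: "j x \<le> \<tau> (code x)" if "x \<in> X" for x using \<tau>_code[OF that] j_t[OF that] by simp
  have p0: "p (code (T w)) 0 = R u" using p_code[OF wT] jw(1) hw(2) by simp
  have j\<tau>w: "\<tau> (code w) = j w" using \<tau>_code[OF w] j_t_eq[OF Z(1)] by simp
  have p1: "p (code w) (\<tau> (code w)) = u" using p_code[OF w] j\<tau>w hw(1) by simp
  obtain y s where yY: "\<And>c. c \<in> K \<Longrightarrow> y c \<in> Y"
    and tr: "\<And>c. c \<in> K \<Longrightarrow> tracks R (\<tau> c) (p c) (m c) d (y c) (s c)"
    and y0: "y (code (T w)) = R u" and y1: "(R ^^ s (code w) (\<tau> (code w))) (y (code w)) = u"
    and dis: "\<And>c c' a b. c \<in> K \<Longrightarrow> c' \<in> K \<Longrightarrow> c \<noteq> c' \<Longrightarrow> a \<le> s c (\<tau> c) \<Longrightarrow> b \<le> s c' (\<tau> c')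
      \<Longrightarrow> (R ^^ a) (y c) \<noteq> (R ^^ b) (y c')"
  proof (rule Y.choose_tracks[of K "code (T w)" "code w" \<tau> p m d u])
    show "\<And>c i. c \<in> K \<Longrightarrow> i < \<tau> c \<Longrightarrow> 0 < m c i \<Longrightarrow> p c (Suc i) = (R ^^ m c i) (p c i)"
      using pstep by blast
  next
    fix y s
    assume "\<And>c. c \<in> K \<Longrightarrow> y c \<in> Y"
      "\<And>c. c \<in> K \<Longrightarrow> tracks R (\<tau> c) (p c) (m c) d (y c) (s c)"
      "y (code (T w)) = R u" "(R ^^ s (code w) (\<tau> (code w))) (y (code w)) = u"
      "\<And>c c' a b. c \<in> K \<Longrightarrow> c' \<in> K \<Longrightarrow> c \<noteq> c' \<Longrightarrow> a \<le> s c (\<tau> c) \<Longrightarrow> b \<le> s c' (\<tau> c')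
      \<Longrightarrow> (R ^^ a) (y c) \<noteq> (R ^^ b) (y c')"
    then show thesis by (rule that)
  qed (use K_fin code_K[OF wT] code_K[OF w] codes_ne pY d u p0 p1 in auto)
  define h' where "h' x = (R ^^ s (code x) (j x)) (y (code x))" for x
  \<comment> \<open>Points of \<open>Z\<close> are top levels, whose image under \<open>T\<close>
    begins a tower, so no waiting time within the segment is available there.\<close>
  define n' where "n' x = (if x \<in> Z then 0 else s (code x) (Suc (j x)) - s (code x) (j x))" for x
  have s_less: "s (code x) (j x) < s (code x) (Suc (j x))" "Suc (j x) \<le> \<tau> (code x)" if "x \<in> X" "x \<notin> Z" for x
  proof -
    have "j x < \<tau> (code x)" using \<tau>_code[OF that(1)] j_t_less[OF that] by simp
    then show "s (code x) (j x) < s (code x) (Suc (j x))" "Suc (j x) \<le> \<tau> (code x)"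
      using tr[OF code_K[OF that(1)]] unfolding tracks_def by auto
  qed
  have s_le: "s (code x) (j x) \<le> s (code x) (\<tau> (code x))" if "x \<in> X" for x
    using tracks_mono[OF tr[OF code_K[OF that]] j_\<tau>[OF that]] by simp
  \<comment> \<open>Visiting times increase along a track, so a time strictly between two
    consecutive visits is not a visit of any level.\<close>
  have s_j: "s (code x) (j x) \<noteq> a" if x: "x \<in> X" "x' \<in> X" "x' \<notin> Z" "code x = code x'"
    and a: "s (code x') (j x') < a" "a < s (code x') (Suc (j x'))" for x x' a
  proof
    assume eq: "s (code x) (j x) = a"
    note mono = tracks_mono[OF tr[OF code_K[OF x(2)]]]
    show False
    proof (cases "j x \<le> j x'")
      case True
      then show False using mono[OF True j_\<tau>[OF x(2)]] eq a x(4) by simp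
    next
      case False
      then show False using mono[of "Suc (j x')" "j x"] j_\<tau>[OF x(1)] eq a x(4) by simp
    qed
  qed
  \<comment> \<open>Different codes have disjoint segments, and aperiodicity tells the times on a
    single segment apart.\<close>
  have same: "code x = code x' \<and> a = a'" if "x \<in> X" "x' \<in> X" "(R ^^ a) (y (code x)) = (R ^^ a') (y (code x'))"
    "a \<le> s (code x) (\<tau> (code x))" "a' \<le> s (code x') (\<tau> (code x'))" for x x' a a'
    using dis[OF code_K[OF that(1)] code_K[OF that(2)] _ that(4,5)] that(3)
      Y.aperiodic[OF yY[OF code_K[OF that(1)]]] by metis

  have "approx h' n'"
    unfolding approx_def
  proof (intro conjI ballI impI)
    show "loc_const X h'"
      unfolding h'_def using loc_const_apply2[OF code_lc j_lc, of "\<lambda>c i. (R ^^ s c i) (y c)"] .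
    show "loc_const X n'"
      unfolding n'_def
      by (rule loc_const_apply2[OF Z_lc loc_const_apply2[OF code_lc j_lc, of "\<lambda>c i. s c (Suc i) - s c i"],
            of "\<lambda>z k. if z then 0 else k"])
    show "h' x \<in> Y" if "x \<in> X" for x
      unfolding h'_def using Y.iter_into yY code_K that by blast
    show "h' (T x) = (R ^^ n' x) (h' x)" if "x \<in> X" "0 < n' x" for x
    proof -
      have nZ: "x \<notin> Z" using that(2) by (auto simp: n'_def)
      have "code (T x) = code x" using b_T[OF that(1) nZ] by (simp add: code_def)
      then have "h' (T x) = (R ^^ (n' x + s (code x) (j x))) (y (code x))"
        using j_T[OF that(1) nZ] nZ s_less(1)[OF that(1) nZ] by (simp add: h'_def n'_def)
      then show ?thesis by (simp add: funpow_add h'_def)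
    qed
    show "h' w = u" using y1 j\<tau>w by (simp add: h'_def)
    have "s (code (T w)) 0 = 0" using tr[OF code_K[OF wT]] by (simp add: tracks_def)
    then show "h' (T w) = R u" using jw(1) y0 by (simp add: h'_def)
    show "n' w = 0" using Z(1) by (simp add: n'_def)
  qed
  moreover have "separated h' n' e"
    unfolding separated_def
  proof (intro conjI ballI impI allI)
    show "dist x w < e" if "x \<in> X" "n' x = 0" for x
    proof -
      have "x \<in> Z" using s_less(1)[OF that(1)] that(2) by (auto simp: n'_def split: if_splits)
      then show ?thesis using U(3) by (auto simp: Z_def dist_commute)
    qed
    show "dist x x' < e" if x: "x \<in> X" "x' \<in> X" "h' x = h' x'" for x x'
    proof -
      have c: "code x = code x'" and sj: "s (code x) (j x) = s (code x') (j x')"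
        using same[OF x(1,2) x(3)[unfolded h'_def] s_le[OF x(1)] s_le[OF x(2)]] by auto
      have "j x = j x'"
        using tracks_strict_mono[OF tr[OF code_K[OF x(1)]]] j_\<tau>[OF x(1)] j_\<tau>[OF x(2)] c sj
        by (metis linorder_neqE_nat less_irrefl)
      \<comment> \<open>Code and level determine \<open>Q\<close>, whose component \<open>q\<close>
        confines both points to one small cell.\<close>
      then have "Q x = Q x'" using Q_code[OF x(1)] Q_code[OF x(2)] c by simp
      then show ?thesis using q(2)[OF x(1,2)] by (simp add: Q_def e'_def)
    qed
    show "(R ^^ i) (h' x) \<noteq> h' x'" if x: "x \<in> X" "x' \<in> X" and i: "0 < i \<and> i < n' x" for x x' i
    proof
      assume eq: "(R ^^ i) (h' x) = h' x'"
      have nZ: "x \<notin> Z" using i by (auto simp: n'_def)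
      let ?a = "i + s (code x) (j x)"
      have eq': "(R ^^ ?a) (y (code x)) = (R ^^ s (code x') (j x')) (y (code x'))"
        using eq by (simp add: h'_def funpow_add)
      have a: "s (code x) (j x) < ?a" "?a < s (code x) (Suc (j x))" using i nZ by (auto simp: n'_def)
      have "?a \<le> s (code x) (\<tau> (code x))"
        using a(2) tracks_mono[OF tr[OF code_K[OF x(1)]] s_less(2)[OF x(1) nZ]] by simp
      from same[OF x eq' this s_le[OF x(2)]] show False
        using s_j[OF x(2) x(1) nZ _ a] by metis
    qed
  qed
  moreover have "dist (h' x) (h x) < d \<and> (0 < n x \<longrightarrow> n' x = n x)" if x: "x \<in> X" for x
  proof
    have "\<forall>i\<le>\<tau> (code x). dist ((R ^^ s (code x) i) (y (code x))) (p (code x) i) < d"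
      using tr[OF code_K[OF x]] by (simp add: tracks_def)
    from this[rule_format, OF j_\<tau>[OF x]] show "dist (h' x) (h x) < d"
      by (simp add: h'_def p_code[OF x])
    show "0 < n x \<longrightarrow> n' x = n x"
    proof
      assume nx: "0 < n x"
      then have nZ: "x \<notin> Z" by (simp add: Z_def)
      have "s (code x) (Suc (j x)) = s (code x) (j x) + m (code x) (j x)"
        using tr[OF code_K[OF x]] s_less(2)[OF x nZ] m_code[OF x] nx unfolding tracks_def
        by (metis Suc_le_eq)
      then show "n' x = n x" using nZ m_code[OF x] by (simp add: n'_def)
    qed
  qed
  ultimately show ?thesis by blast
qed

end

subsection \<open>The limit\<close>

context minimal_pair
begin

text \<open>The case \<open>i = 0\<close> protects distinct values of \<open>h\<close>, the cases
  \<open>0 < i < n x\<close> protect the avoidance of the image between returns. Both survive errors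
  below \<open>r\<close>.\<close>

definition robust :: "('a \<Rightarrow> 'b) \<Rightarrow> ('a \<Rightarrow> nat) \<Rightarrow> real \<Rightarrow> bool" where
  "robust h n r \<longleftrightarrow> (\<forall>x\<in>X. \<forall>x'\<in>X. \<forall>i\<le>n x. (R ^^ i) (h x) \<noteq> h x' \<longrightarrow>
     (\<forall>v\<in>Y. \<forall>v'. dist v (h x) < r \<longrightarrow> dist v' (h x') < r \<longrightarrow> (R ^^ i) v \<noteq> v'))"

text \<open>Two values suffice: \<open>T w \<noteq> w\<close> by aperiodicity, so a clopen set
  containing \<open>w\<close> but not \<open>T w\<close> can be sent to \<open>u\<close> and the
  rest to \<open>R u\<close>.\<close>

lemma approx_init: "\<exists>h. approx h (\<lambda>_. 0)"
proof -
  have ne: "T w \<noteq> w" using X.aperiodic[OF w, of 1 0] by auto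
  then have "dist (T w) w > 0" by simp
  then obtain U where U: "w \<in> U" "U \<subseteq> X" "U \<subseteq> ball w (dist (T w) w)" "loc_const X (\<lambda>z. z \<in> U)"
    by (rule cantor_set_clopen_nbhd[OF cantor w])
  have "T w \<notin> U" using U(3) by (auto simp: dist_commute)
  then have "approx (\<lambda>x. if x \<in> U then u else R u) (\<lambda>_. 0)"
    unfolding approx_def using U(1) u Y.into[OF u]
      loc_const_apply[OF U(4), of "\<lambda>z. if z then u else R u"] by (simp add: loc_const_const)
  then show ?thesis by blast
qed

text \<open>Local constancy on a compact set leaves finitely many values of \<open>h\<close> and a
  bound on \<open>n\<close>, so \<open>separation_margin\<close> applies.\<close>

lemma robust_exists:
  assumes "approx h n" "\<rho> > 0"
  obtains r where "0 < r" "r \<le> \<rho>" "robust h n r"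
proof -
  have h: "loc_const X h" "loc_const X n" "h ` X \<subseteq> Y" using assms(1) by (auto simp: approx_def)
  have fin: "finite (h ` X)" "finite (n ` X)"
    using loc_const_finite_image[OF X.compact] h(1,2) by auto
  obtain N where N: "\<forall>k\<in>n ` X. k \<le> N" using fin(2) by (meson finite_nat_set_iff_bounded_le)
  obtain r where r: "r > 0" "\<And>v v' i u u'. v \<in> h ` X \<Longrightarrow> v' \<in> h ` X \<Longrightarrow> i \<le> N \<Longrightarrow> (R ^^ i) v \<noteq> v' \<Longrightarrow>
      u \<in> Y \<Longrightarrow> dist u v < r \<Longrightarrow> dist u' v' < r \<Longrightarrow> (R ^^ i) u \<noteq> u'"
    by (rule Y.separation_margin[OF fin(1) h(3), where N = N]) (rule that, blast+)
  have "robust h n (min r \<rho>)"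
    unfolding robust_def
  proof (intro ballI allI impI)
    fix x x' i v v'
    assume "x \<in> X" "x' \<in> X" "i \<le> n x" "(R ^^ i) (h x) \<noteq> h x'" "v \<in> Y"
      "dist v (h x) < min r \<rho>" "dist v' (h x') < min r \<rho>"
    then show "(R ^^ i) v \<noteq> v'"
      using r(2)[of "h x" "h x'" i v v'] N by (meson image_eqI le_trans min_less_iff_conj)
  qed
  then show thesis using that[of "min r \<rho>"] r(1) assms(2) by simp
qed

lemma robust_refine:
  assumes "approx h n" "e > 0" "d > 0" "\<rho> > 0"
  obtains h' n' r' where "approx h' n'" "separated h' n' e" "robust h' n' r'" "0 < r'" "r' \<le> \<rho>"
    "\<And>x. x \<in> X \<Longrightarrow> dist (h' x) (h x) < d \<and> (0 < n x \<longrightarrow> n' x = n x)"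
proof -
  obtain h' n' where h': "approx h' n'" "separated h' n' e"
    "\<And>x. x \<in> X \<Longrightarrow> dist (h' x) (h x) < d \<and> (0 < n x \<longrightarrow> n' x = n x)"
    using approx_refine[OF assms(1-3)] by blast
  obtain r' where "0 < r'" "r' \<le> \<rho>" "robust h' n' r'" by (rule robust_exists[OF h'(1) assms(4)])
  then show thesis using that[of h' n' r'] h' by blast
qed

text \<open>Steps below \<open>r k / 4\<close> together with halving of \<open>r\<close> keep the
  total drift after stage \<open>k\<close> within \<open>r k / 2\<close>, inside the margin of that
  stage.\<close>

lemma approx_sequence:
  obtains h n r where "\<And>k. approx (h k) (n k)" "\<And>k. separated (h k) (n k) (1 / Suc k)"
    "\<And>k. robust (h k) (n k) (r k)" "\<And>k. 0 < r k" "\<And>k. r k \<le> 1 / Suc k"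
    "\<And>k x. x \<in> X \<Longrightarrow> dist (h (Suc k) x) (h k x) < r k / 4"
    "\<And>k x. x \<in> X \<Longrightarrow> 0 < n k x \<Longrightarrow> n (Suc k) x = n k x"
    "\<And>k. r (Suc k) \<le> r k / 2"
proof -
  define P where "P k = (\<lambda>(h, n, r). approx h n \<and> separated h n (1 / Suc k) \<and> robust h n r
      \<and> 0 < r \<and> r \<le> 1 / Suc k)" for k :: nat
  define Q where "Q = (\<lambda>(h :: 'a \<Rightarrow> 'b, n :: 'a \<Rightarrow> nat, r) (h', n', r'). (\<forall>x\<in>X. dist (h' x) (h x) < r / 4
      \<and> (0 < n x \<longrightarrow> n' x = n x)) \<and> r' \<le> (r::real) / 2)"
  have "\<exists>f. \<forall>k. P k (f k) \<and> Q (f k) (f (Suc k))"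
  proof (rule dependent_nat_choice)
    \<comment> \<open>The initial map need not be separated, so stage 0 is already one refinement of
      it.\<close>
    obtain h where h: "approx h (\<lambda>_. 0)" using approx_init by blast
    obtain h' n' r' where "approx h' n'" "separated h' n' 1" "robust h' n' r'" "0 < r'" "r' \<le> 1"
      by (rule robust_refine[OF h zero_less_one zero_less_one zero_less_one])
    then have "P 0 (h', n', r')" by (simp add: P_def)
    then show "\<exists>s. P 0 s" by blast
  next
    fix s k assume "P k s"
    moreover obtain h n r where s: "s = (h, n, r)" by (cases s)
    ultimately have hn: "approx h n" and r: "0 < r" "r / 4 > 0" by (auto simp: P_def)
    have pos: "1 / real (Suc (Suc k)) > 0" "min (r / 2) (1 / real (Suc (Suc k))) > 0" using r by auto
    obtain h' n' r' where "approx h' n'" "separated h' n' (1 / Suc (Suc k))" "robust h' n' r'" "0 < r'"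
      "r' \<le> min (r / 2) (1 / Suc (Suc k))"
      "\<And>x. x \<in> X \<Longrightarrow> dist (h' x) (h x) < r / 4 \<and> (0 < n x \<longrightarrow> n' x = n x)"
      by (rule robust_refine[OF hn pos(1) r(2) pos(2)]) (rule that, blast+)
    then have "P (Suc k) (h', n', r') \<and> Q s (h', n', r')" by (simp add: P_def Q_def s)
    then show "\<exists>s'. P (Suc k) s' \<and> Q s s'" by blast
  qed
  then obtain f where f: "\<And>k. P k (f k)" "\<And>k. Q (f k) (f (Suc k))" by blast
  define h where "h k = fst (f k)" for k
  define n where "n k = fst (snd (f k))" for k
  define r where "r k = snd (snd (f k))" for k
  have fk: "f k = (h k, n k, r k)" for k by (simp add: h_def n_def r_def)
  show thesis
    using f unfolding fk P_def Q_def prod.case by (intro that[of h n r]) blast+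
qed

lemma embedding_exists:
  obtains H where "continuous_on X H" "inj_on H X" "H ` X \<subseteq> Y"
    "\<And>x. x \<in> X \<Longrightarrow> \<exists>m>0. H (T x) = (R ^^ m) (H x) \<and> (\<forall>i. 0 < i \<and> i < m \<longrightarrow> (R ^^ i) (H x) \<notin> H ` X)"
proof -
  obtain h n r where approx: "\<And>k. approx (h k) (n k)" and sep: "\<And>k. separated (h k) (n k) (1 / Suc k)"
    and rob: "\<And>k. robust (h k) (n k) (r k)" and rpos: "\<And>k. 0 < r k" and r1: "\<And>k. r k \<le> 1 / Suc k"
    and close: "\<And>k x. x \<in> X \<Longrightarrow> dist (h (Suc k) x) (h k x) < r k / 4"
    and ext: "\<And>k x. x \<in> X \<Longrightarrow> 0 < n k x \<Longrightarrow> n (Suc k) x = n k x"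
    and rhalf: "\<And>k. r (Suc k) \<le> r k / 2"
    by (rule approx_sequence) (rule that, blast+)
  have small: "\<exists>k. 1 / real (Suc k) < e" if "e > 0" for e :: real
    using reals_Archimedean[OF that] by (auto simp: inverse_eq_divide)
  have far: "dist (h (k + l) x) (h k x) \<le> r k / 2" if "x \<in> X" for k l x
  proof (induction l arbitrary: k)
    case 0 then show ?case using rpos[of k] by simp
  next
    case (Suc l)
    have "dist (h (Suc k + l) x) (h (Suc k) x) \<le> r k / 4" using Suc[of "Suc k"] rhalf[of k] by simp
    then show ?case
      using close[OF that, of k] dist_triangle[of "h (Suc k + l) x" "h k x" "h (Suc k) x"] by simp
  qed
  have hY: "h k x \<in> Y" if "x \<in> X" for k x using approx[of k] that by (simp add: approx_def)
  have "\<forall>x\<in>X. \<exists>l. l \<in> Y \<and> (\<lambda>k. h k x) \<longlonglongrightarrow> l"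
  proof
    fix x assume x: "x \<in> X"
    have "Cauchy (\<lambda>k. h k x)"
      unfolding Cauchy_altdef2
    proof (intro allI impI)
      fix e :: real assume "e > 0"
      then obtain k where "1 / real (Suc k) < e" using small by blast
      then have "r k / 2 < e" using r1[of k] rpos[of k] by linarith
      then have "dist (h m x) (h k x) < e" if "m \<ge> k" for m
        using far[OF x, of k "m - k"] that by simp
      then show "\<exists>k. \<forall>m\<ge>k. dist (h m x) (h k x) < e" by blast
    qed
    then obtain l where "l \<in> Y" "(\<lambda>k. h k x) \<longlonglongrightarrow> l"
      using completeE[OF compact_imp_complete[OF Y.compact], of "\<lambda>k. h k x"] hY[OF x] by metis
    then show "\<exists>l. l \<in> Y \<and> (\<lambda>k. h k x) \<longlonglongrightarrow> l" by (intro exI[of _ l] conjI)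
  qed
  from bchoice[OF this] obtain H where HY: "\<And>x. x \<in> X \<Longrightarrow> H x \<in> Y"
    and lim: "\<And>x. x \<in> X \<Longrightarrow> (\<lambda>k. h k x) \<longlonglongrightarrow> H x" by auto
  have near: "dist (H x) (h k x) \<le> r k / 2" if x: "x \<in> X" for x k
  proof -
    have "eventually (\<lambda>m. dist (h k x) (h m x) \<le> r k / 2) sequentially"
      unfolding eventually_sequentially using far[OF x, of k]
      by (metis dist_commute le_add_diff_inverse)
    then have "dist (h k x) (H x) \<le> r k / 2"
      by (rule Lim_dist_ubound[OF sequentially_bot lim[OF x]])
    then show ?thesis by (simp add: dist_commute)
  qed
  have near': "dist (H x) (h k x) < r k" if x: "x \<in> X" for x k
    using near[OF x, of k] rpos[of k] by linarith
  \<comment> \<open>The limit stays within \<open>r k\<close> of \<open>h k\<close>, so every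
    inequality secured at stage \<open>k\<close> passes to \<open>H\<close>.\<close>
  have apart: "(R ^^ i) (H x) \<noteq> H x'" if "x \<in> X" "x' \<in> X" "i \<le> n k x" "(R ^^ i) (h k x) \<noteq> h k x'" for i k x x'
    using rob[of k] that near' HY unfolding robust_def by blast
  have cont: "continuous_on X H"
    unfolding continuous_on_iff
  proof (intro ballI allI impI)
    fix x and e :: real assume x: "x \<in> X" and "e > 0"
    then obtain k where "1 / real (Suc k) < e" using small by blast
    then have k: "r k < e" using r1[of k] by linarith
    obtain d where d: "d > 0" "\<And>x'. x' \<in> X \<Longrightarrow> dist x' x < d \<Longrightarrow> h k x' = h k x"
      using approx[of k] x unfolding approx_def loc_const_def by blast
    have "dist (H x') (H x) < e" if x': "x' \<in> X" "dist x' x < d" for x'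
      using near[OF x, of k] near[OF x'(1), of k] d(2)[OF x'] k
        dist_triangle2[of "H x'" "H x" "h k x"] by simp
    then show "\<exists>d>0. \<forall>x'\<in>X. dist x' x < d \<longrightarrow> dist (H x') (H x) < e" using d(1) by blast
  qed
  have inj: "inj_on H X"
  proof (rule inj_onI, rule ccontr)
    fix x x' assume x: "x \<in> X" "x' \<in> X" "H x = H x'" "x \<noteq> x'"
    then obtain k where k: "1 / real (Suc k) < dist x x'" using small[of "dist x x'"] by auto
    then have "h k x \<noteq> h k x'" using sep[of k] x(1,2) unfolding separated_def by force
    then show False using apart[of x x' 0 k] x by simp
  qed
  have ret: "\<exists>m>0. H (T x) = (R ^^ m) (H x) \<and> (\<forall>i. 0 < i \<and> i < m \<longrightarrow> (R ^^ i) (H x) \<notin> H ` X)"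
    if x: "x \<in> X" for x
  proof (cases "x = w")
    case True
    \<comment> \<open>At \<open>w\<close> no stage decides a time, but both values are constant in
      \<open>k\<close>, which gives return time 1 in the limit.\<close>
    have "h k w = u" "h k (T w) = R u" for k using approx[of k] by (auto simp: approx_def)
    then have "H w = u" "H (T w) = R u"
      using lim[OF w] lim[OF X.into[OF w]] by (simp_all add: LIMSEQ_const_iff)
    then show ?thesis using True by (intro exI[of _ 1]) auto
  next
    case False
    \<comment> \<open>Any other point is decided once \<open>1 / Suc k\<close> drops below its
      distance to \<open>w\<close>; its time is then frozen, and the return equation passes to the
      limit by continuity of that one iterate.\<close>
    then obtain k where "1 / real (Suc k) < dist x w" using small[of "dist x w"] by auto
    then have npos: "0 < n k x" using sep[of k] x unfolding separated_def by force
    have n_eq: "n (k + l) x = n k x" for l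
      by (induction l) (use ext[OF x] npos in auto)
    have "h (k + l) (T x) = (R ^^ n k x) (h (k + l) x)" for l
      using approx[of "k + l"] x npos n_eq[of l] unfolding approx_def by auto
    moreover have "(\<lambda>l. h (k + l) (T x)) \<longlonglongrightarrow> H (T x)"
      using LIMSEQ_ignore_initial_segment[OF lim[OF X.into[OF x]], of k] by (simp add: add.commute)
    moreover have "(\<lambda>l. (R ^^ n k x) (h (k + l) x)) \<longlonglongrightarrow> (R ^^ n k x) (H x)"
    proof (rule continuous_on_tendsto_compose[OF Y.cont_iter])
      show "(\<lambda>l. h (k + l) x) \<longlonglongrightarrow> H x"
        using LIMSEQ_ignore_initial_segment[OF lim[OF x], of k] by (simp add: add.commute)
    qed (use HY[OF x] hY[OF x] in auto)
    ultimately have "H (T x) = (R ^^ n k x) (H x)" using LIMSEQ_unique by auto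
    moreover have "(R ^^ i) (H x) \<notin> H ` X" if i: "0 < i \<and> i < n k x" for i
    proof
      assume "(R ^^ i) (H x) \<in> H ` X"
      then obtain x' where x': "x' \<in> X" "(R ^^ i) (H x) = H x'" by blast
      have "(R ^^ i) (h k x) \<noteq> h k x'" using sep[of k] x x'(1) i unfolding separated_def by blast
      then show False using apart[OF x x'(1), of i k] i x'(2) by simp
    qed
    ultimately show ?thesis using npos by blast
  qed
  show thesis using that[OF cont inj _ ret] HY by blast
qed

end

section \<open>From Cantor systems to the abstract setting, and the Poincare section\<close>

lemma minimal_cantor_system_imp_minimal_system:
  assumes "minimal_cantor_system X T" "homeomorphism X X T g"
  shows "minimal_system X T g"
proof
  have X: "cantor_set X" "\<And>x. x \<in> X \<Longrightarrow> X \<subseteq> closure (full_orbit X T x)"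
    using assms(1) by (auto simp: minimal_cantor_system_def)
  show "compact X" "\<And>x. x \<in> X \<Longrightarrow> x islimpt X" using X(1) by (auto simp: cantor_set_def)
  show "continuous_on X T" "continuous_on X g" "\<And>x. x \<in> X \<Longrightarrow> T x \<in> X" "\<And>x. x \<in> X \<Longrightarrow> g x \<in> X"
    "\<And>x. x \<in> X \<Longrightarrow> g (T x) = x" "\<And>x. x \<in> X \<Longrightarrow> T (g x) = x"
    using assms(2) by (auto simp: homeomorphism_def)
  fix x V assume x: "x \<in> X" and V: "open V" "V \<inter> X \<noteq> {}"
  have inj: "inj_on T X" using assms(2) by (metis homeomorphism_def inj_on_inverseI)
  \<comment> \<open>Backward orbits stay in \<open>X\<close>, where \<open>inv_into X T\<close>
    agrees with \<open>g\<close>.\<close>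
  have iter: "(inv_into X T ^^ k) x = (g ^^ k) x \<and> (g ^^ k) x \<in> X" for k
  proof (induction k)
    case (Suc k)
    then have "T (g ((g ^^ k) x)) = (g ^^ k) x" "g ((g ^^ k) x) \<in> X"
      using assms(2) by (auto simp: homeomorphism_def)
    then show ?case using Suc inj by (simp add: inv_into_f_eq)
  qed (simp add: x)
  have "V \<inter> full_orbit X T x \<noteq> {}"
    using V X(2)[OF x] open_Int_closure_eq_empty[OF V(1), of "full_orbit X T x"] by blast
  then show "\<exists>k. (T ^^ k) x \<in> V \<or> (g ^^ k) x \<in> V"
    using iter unfolding full_orbit_def by auto
qed

theorem mainTheorem5:
  fixes X :: "'a::metric_space set" and T :: "'a \<Rightarrow> 'a"
    and Y :: "'b::metric_space set" and R :: "'b \<Rightarrow> 'b"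
  assumes "minimal_cantor_system X T" and "minimal_cantor_system Y R"
  shows "\<exists>C. poincare_section Y R C \<and> top_conjugate C (first_return_map R C) X T"
proof -
  obtain T' where T': "homeomorphism X X T T'" using assms(1) by (auto simp: minimal_cantor_system_def)
  obtain R' where R': "homeomorphism Y Y R R'" using assms(2) by (auto simp: minimal_cantor_system_def)
  have cX: "cantor_set X" and "cantor_set Y"
    using assms by (auto simp: minimal_cantor_system_def)
  then obtain w u where wu: "w \<in> X" "u \<in> Y" by (auto simp: cantor_set_def)
  interpret X: minimal_system X T T' by (rule minimal_cantor_system_imp_minimal_system[OF assms(1) T'])
  interpret Y: minimal_system Y R R' by (rule minimal_cantor_system_imp_minimal_system[OF assms(2) R'])
  interpret minimal_pair X T T' Y R R' w u by unfold_locales (use wu cX in auto)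
  obtain H where cont: "continuous_on X H" and inj: "inj_on H X" and HY: "H ` X \<subseteq> Y"
    and ret: "\<And>x. x \<in> X \<Longrightarrow> \<exists>m>0. H (T x) = (R ^^ m) (H x) \<and> (\<forall>i. 0 < i \<and> i < m \<longrightarrow> (R ^^ i) (H x) \<notin> H ` X)"
    by (rule embedding_exists) (rule that, blast+)
  define C where "C = H ` X"
  have frm: "first_return_map R C (H x) = H (T x)" if x: "x \<in> X" for x
  proof -
    obtain m where m: "m > 0" "H (T x) = (R ^^ m) (H x)" "\<forall>i. 0 < i \<and> i < m \<longrightarrow> (R ^^ i) (H x) \<notin> C"
      using ret[OF x] unfolding C_def by blast
    have "return_time R C (H x) = m"
      unfolding return_time_def
    proof (rule Least_equality)
      show "0 < m \<and> (R ^^ m) (H x) \<in> C" using m X.into[OF x] unfolding C_def by (metis image_eqI)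
      show "m \<le> i" if "0 < i \<and> (R ^^ i) (H x) \<in> C" for i using m(3) that by (meson not_less)
    qed
    then show ?thesis using m(2) by (simp add: first_return_map_def)
  qed
  obtain g where g: "homeomorphism X C H g"
    using homeomorphism_compact[OF X.compact cont _ inj] unfolding C_def by blast
  have gH: "g (H x) = x" if "x \<in> X" for x using homeomorphism_apply1[OF g that] .
  \<comment> \<open>Continuity of the return map comes from transporting \<open>T\<close> through
    \<open>H\<close>, not from the return time, which may be unbounded.\<close>
  have "homeomorphism C C (H \<circ> (T \<circ> g)) ((H \<circ> T') \<circ> g)"
    using homeomorphism_compose[OF homeomorphism_compose[OF homeomorphism_symD[OF g] T'] g] .
  then have homeo: "homeomorphism C C (first_return_map R C) ((H \<circ> T') \<circ> g)"
    by (rule homeomorphism_cong) (use frm in \<open>auto simp: C_def gH\<close>)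
  have "\<exists>m>0. (R ^^ m) c \<in> C" if "c \<in> C" for c
    using that ret X.into unfolding C_def by (metis (no_types, lifting) image_iff)
  moreover have "closed C"
    unfolding C_def using compact_continuous_image[OF cont X.compact] by (rule compact_imp_closed)
  ultimately have "poincare_section Y R C"
    unfolding poincare_section_def using homeo HY wu(1) unfolding C_def by blast
  moreover have "top_conjugate C (first_return_map R C) X T"
    unfolding top_conjugate_def using homeomorphism_symD[OF g] frm gH X.into
    by (intro exI[of _ g] exI[of _ H]) (auto simp: C_def)
  ultimately show ?thesis by blast
qed

end
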